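(* For every $n\ge1$, $$\sum_{\sigma\in\mathfrak S_n}\mathbf{\Psi}^\sigma=\sum_{I,J\,\vDash\, n}c_{IJ}(q)\,R_I^{(J)},$$ where the sum is over all pairs of compositions of $n$ and $$c_{IJ}(q)=\begin{cases}0&\text{if }\mathrm{Des}(I)\setminus\mathrm{Des}(I)^-\not\subset\mathrm{Des}(J),\\ (-q)^{|\mathrm{Des}(I)\setminus\mathrm{Des}(J)|}\,(1-q)^{|\mathrm{Des}(I)\cap\mathrm{Des}(J)|}&\text{otherwise.}\end{cases}$$
   Context: Scalars: $q$ is an indeterminate (scalar parameter). Biwords. For $n\ge 0$, a permutation $\tau\in\mathfrak S_n$ (written as a word) and a word $u=u_1\cdots u_n$ of positive integers (a color word), let $\binom{u}{\tau}$ denote a formal basis element (this is $\mathbf G_{\tau,u}$ in the algebra of colored free quasi-symmetric functions; top row = colors, bottom row = permutation). Product: $\binom{u}{\alpha}\binom{v}{\beta}=\sum_{\gamma\in\alpha*\beta}\binom{uv}{\gamma}$, where, for $\alpha\in\mathfrak S_a$, $\beta\in\mathfrak S_b$, $\alpha*\beta$ is the set (formal sum) of all $\gamma\in\mathfrak S_{a+b}$ which, written $\gamma=xy$ with $|x|=a$, $|y|=b$, satisfy $\mathrm{std}(x)=\alpha$, $\mathrm{std}(y)=\beta$; $\mathrm{std}$ denotes standardization (the permutation with the same relative order of letters). The elements $\Psi^u$. For a color word $u=u_1\cdots u_p$, regard $(u_i,i)$ as biletters, set $B_1=(u_1,1)$ and $B_i=[B_{i-1},(u_i,i)]_q$ for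 $i\ge2$, where $[x,y]_q=xy-q\,yx$ and products of biletters are concatenation of words in biletters. Interpreting each resulting word in biletters as a biword (colors on top, numbers below), put $\Psi^u:=B_p$. E.g. $\Psi^{312}=\binom{312}{123}-q\binom{132}{213}-q\binom{231}{312}+q^2\binom{213}{321}$. A word $u=u_1\cdots u_p$ is initially dominated if $u_1>u_i$ for all $i>1$. Each word has a unique factorization $u=u^{(1)}u^{(2)}\cdots u^{(p)}$ into initially dominated words whose first letters satisfy $u^{(1)}_1\le u^{(2)}_1\le\cdots\le u^{(p)}_1$. For $\sigma\in\mathfrak S_n$ with this factorization, $\mathbf\Psi^\sigma:=\Psi^{u^{(1)}}\Psi^{u^{(2)}}\cdots\Psi^{u^{(p)}}$ (product of biwords above), and the saillance composition of $\sigma$ is $S(\sigma):=(|u^{(1)}|,\dots,|u^{(p)}|)$. Compositions. $I\vDash n$ means $I$ is a composition of $n$. For $I=(i_1,\dots,i_s)\vDash n$, $\mathrm{Des}(I)=\{i_1,i_1+i_2,\dots,i_1+\cdots+i_{s-1}\}$ and $\mathrm{Des}(I)^-=\{d-1: d\in\mathrm{Des}(I)\}$. The descent composition $D(\tau)$ of $\tau\in\mathfrak S_n$ is the composition whose parts are the lengths of the maximal increasing factors of $\tau$. For $I,J\vDash n$ let $R_I^{(J)}:=\sum_{\tau,\sigma\in\mathfrak S_n:\ D(\tau)=I,\ S(\sigma)=J}\binom{\sigma}{\tau}$. *)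

theory Defs
  imports "HOL-Library.Poly_Mapping" "HOL-Combinatorics.Multiset_Permutations"
begin

section \<open>Linear and bilinear extension\<close>

text \<open>Formal linear combinations of basis elements of type \<open>'b\<close> with coefficients in \<open>'a\<close> are
  elements of \<open>'b \<Rightarrow>\<^sub>0 'a\<close>; the basis element \<open>b\<close> itself is \<open>basis b\<close>. The product of
  \<open>HOL-Library.Poly_Mapping\<close> is not used.\<close>

abbreviation basis :: "'b \<Rightarrow> ('b \<Rightarrow>\<^sub>0 'a::comm_ring_1)"
  where "basis b \<equiv> Poly_Mapping.single b 1"

definition scale :: "'a::comm_ring_1 \<Rightarrow> ('b \<Rightarrow>\<^sub>0 'a) \<Rightarrow> ('b \<Rightarrow>\<^sub>0 'a)"
  where "scale c x = Poly_Mapping.map ((*) c) x"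

definition lin_ext :: "('b \<Rightarrow> ('c \<Rightarrow>\<^sub>0 'a)) \<Rightarrow> ('b \<Rightarrow>\<^sub>0 'a) \<Rightarrow> ('c \<Rightarrow>\<^sub>0 'a::comm_ring_1)"
  where "lin_ext f x = (\<Sum>b\<in>Poly_Mapping.keys x. scale (Poly_Mapping.lookup x b) (f b))"

definition bilin_ext ::
    "('b \<Rightarrow> 'c \<Rightarrow> ('d \<Rightarrow>\<^sub>0 'a)) \<Rightarrow> ('b \<Rightarrow>\<^sub>0 'a) \<Rightarrow> ('c \<Rightarrow>\<^sub>0 'a) \<Rightarrow> ('d \<Rightarrow>\<^sub>0 'a::comm_ring_1)"
  where "bilin_ext f x y = lin_ext (\<lambda>b. lin_ext (f b) y) x"


section \<open>Biwords\<close>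

text \<open>The elements of \<open>\<SS>\<^sub>n\<close>, as words, are the elements of \<open>permutations_of_set {1..n}\<close>.
  A pair \<open>(u, \<tau>)\<close> stands for the biword with top row (colors) \<open>u\<close> and bottom row (permutation)
  \<open>\<tau>\<close>. The type also contains pairs that are not biwords; the product of two basis
  elements is zero if a bottom row is not a permutation.\<close>

type_synonym biword = "nat list \<times> nat list"

text \<open>Standardization, for words without repeated letters.\<close>

definition std :: "nat list \<Rightarrow> nat list"
  where "std x = map (\<lambda>a. card {b \<in> set x. b \<le> a}) x"

definition conv :: "nat list \<Rightarrow> nat list \<Rightarrow> nat list set"
  where "conv \<alpha> \<beta> = {\<gamma> \<in> permutations_of_set {1..length \<alpha> + length \<beta>}.
    \<exists>x y. \<gamma> = x @ y \<and> length x = length \<alpha> \<and> length y = length \<beta> \<and> std x = \<alpha> \<and> std y = \<beta>}"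

definition biword_prod ::
    "(biword \<Rightarrow>\<^sub>0 'a) \<Rightarrow> (biword \<Rightarrow>\<^sub>0 'a) \<Rightarrow> (biword \<Rightarrow>\<^sub>0 'a::comm_ring_1)"
  where "biword_prod = bilin_ext (\<lambda>(u, \<alpha>) (v, \<beta>). \<Sum>\<gamma>\<in>conv \<alpha> \<beta>. basis (u @ v, \<gamma>))"


section \<open>The elements \<open>\<Psi>\<^sup>u\<close>\<close>

text \<open>The biletter \<open>(u\<^sub>i, i)\<close> consists of a color and a number.\<close>

type_synonym biletter = "nat \<times> nat"

definition concat_prod ::
    "(biletter list \<Rightarrow>\<^sub>0 'a) \<Rightarrow> (biletter list \<Rightarrow>\<^sub>0 'a) \<Rightarrow> (biletter list \<Rightarrow>\<^sub>0 'a::comm_ring_1)"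
  where "concat_prod = bilin_ext (\<lambda>v w. basis (v @ w))"

definition q_bracket ::
    "'a \<Rightarrow> (biletter list \<Rightarrow>\<^sub>0 'a) \<Rightarrow> (biletter list \<Rightarrow>\<^sub>0 'a) \<Rightarrow> (biletter list \<Rightarrow>\<^sub>0 'a::comm_ring_1)"
  where "q_bracket q x y = concat_prod x y - scale q (concat_prod y x)"

definition biword_of :: "biletter list \<Rightarrow> biword"
  where "biword_of w = (map fst w, map snd w)"

text \<open>The value at the empty word is irrelevant.\<close>

definition Psi_word :: "'a::comm_ring_1 \<Rightarrow> nat list \<Rightarrow> (biword \<Rightarrow>\<^sub>0 'a)"
  where "Psi_word q u = (case zip u [1..<Suc (length u)] of
      [] \<Rightarrow> 0
    | b # bs \<Rightarrow> lin_ext (\<lambda>w. basis (biword_of w))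
        (foldl (\<lambda>B c. q_bracket q B (basis [c])) (basis [b]) bs))"


section \<open>Initially dominated words and saillance composition\<close>

definition initially_dominated :: "nat list \<Rightarrow> bool"
  where "initially_dominated u \<longleftrightarrow> u \<noteq> [] \<and> (\<forall>a\<in>set (tl u). a < hd u)"

definition is_dom_factorization :: "nat list \<Rightarrow> nat list list \<Rightarrow> bool"
  where "is_dom_factorization u ws \<longleftrightarrow>
    concat ws = u \<and> (\<forall>w\<in>set ws. initially_dominated w) \<and> sorted (map hd ws)"

lemma ex1_dom_factorization: "\<exists>!ws. is_dom_factorization u ws"
proof (induction u rule: length_induct)
  case (1 u)
  show ?case
  proof (cases u)
    case Nil
    have "is_dom_factorization [] ws \<longleftrightarrow> ws = []" for ws
      by (cases ws) (auto simp: is_dom_factorization_def initially_dominated_def)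
    then show ?thesis using Nil by simp
  next
    case (Cons x v)
    let ?t = "takeWhile (\<lambda>a. a < x) v" and ?d = "dropWhile (\<lambda>a. a < x) v"
    have "length ?d < length u"
      using Cons by (simp add: length_dropWhile_le less_Suc_eq_le)
    then obtain r where r: "is_dom_factorization ?d r"
      and r1: "\<And>s. is_dom_factorization ?d s \<Longrightarrow> s = r"
      using 1 by blast
    have "is_dom_factorization u ((x # ?t) # r)"
    proof -
      have "x \<le> hd w" if w: "w \<in> set r" for w
      proof -
        obtain w0 r0 where r0: "r = w0 # r0" using w by (cases r) auto
        have le: "hd w0 \<le> hd w" using r w r0 by (auto simp: is_dom_factorization_def)
        have "w0 \<noteq> []" using r r0
          by (auto simp: is_dom_factorization_def initially_dominated_def)
        moreover have d: "?d = w0 @ concat r0" using r r0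
          by (simp add: is_dom_factorization_def)
        ultimately have "?d \<noteq> []" "hd w0 = hd ?d" by (simp_all add: d)
        then have "x \<le> hd w0" using hd_dropWhile[of "\<lambda>a. a < x" v] by simp
        with le show ?thesis by simp
      qed
      then show ?thesis using r Cons
        by (auto simp: is_dom_factorization_def initially_dominated_def dest: set_takeWhileD)
    qed
    moreover have "ws = (x # ?t) # r" if ws: "is_dom_factorization u ws" for ws
    proof -
      obtain w s where s: "ws = w # s" using ws Cons
        by (cases ws) (auto simp: is_dom_factorization_def)
      then obtain t where t: "w = x # t" using ws Cons
        by (cases w) (auto simp: is_dom_factorization_def initially_dominated_def)
      have v: "v = t @ concat s" using ws s t Cons by (auto simp: is_dom_factorization_def)
      have lt: "\<forall>a\<in>set t. a < x"
        using ws s t by (auto simp: is_dom_factorization_def initially_dominated_def)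
      have "concat s = [] \<or> \<not> hd (concat s) < x"
      proof (cases s)
        case Nil
        then show ?thesis by simp
      next
        case (Cons w1 s1)
        have "w1 \<noteq> []" "x \<le> hd w1"
          using ws by (auto simp: s t Cons is_dom_factorization_def initially_dominated_def)
        then show ?thesis by (simp add: Cons)
      qed
      then have "takeWhile (\<lambda>a. a < x) y = [] \<and> dropWhile (\<lambda>a. a < x) y = y"
        if "y = concat s" for y
        unfolding that[symmetric] by (cases y) simp_all
      then have "?t = t \<and> ?d = concat s"
        unfolding v using lt by (simp add: takeWhile_append2 dropWhile_append2)
      moreover have "is_dom_factorization (concat s) s"
        using ws s by (auto simp: is_dom_factorization_def)
      ultimately show ?thesis using r1 s t by auto
    qed
    ultimately show ?thesis by blast
  qed
qed

definition dom_factorization :: "nat list \<Rightarrow> nat list list"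
  where "dom_factorization u = (THE ws. is_dom_factorization u ws)"

definition saillance_comp :: "nat list \<Rightarrow> nat list"
  where "saillance_comp \<sigma> = map length (dom_factorization \<sigma>)"

definition Psi_perm :: "'a::comm_ring_1 \<Rightarrow> nat list \<Rightarrow> (biword \<Rightarrow>\<^sub>0 'a)"
  where "Psi_perm q \<sigma> = foldr biword_prod (map (Psi_word q) (dom_factorization \<sigma>)) (basis ([], []))"


section \<open>Compositions and descents\<close>

definition compositions :: "nat \<Rightarrow> nat list set"
  where "compositions n = {I. (\<forall>i\<in>set I. i \<ge> 1) \<and> sum_list I = n}"

definition Des :: "nat list \<Rightarrow> nat set"
  where "Des I = {sum_list (take k I) | k. 1 \<le> k \<and> k < length I}"

definition Des_minus :: "nat list \<Rightarrow> nat set"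
  where "Des_minus I = {d - 1 | d. d \<in> Des I}"

text \<open>The last condition expresses that the increasing factors are maximal.\<close>

definition is_run_factorization :: "nat list \<Rightarrow> nat list list \<Rightarrow> bool"
  where "is_run_factorization \<tau> ws \<longleftrightarrow>
    concat ws = \<tau> \<and> (\<forall>w\<in>set ws. w \<noteq> [] \<and> sorted_wrt (<) w) \<and>
    successively (\<lambda>v w. \<not> last v < hd w) ws"

lemma ex1_run_factorization: "\<exists>!ws. is_run_factorization \<tau> ws"
proof (induction \<tau>)
  case Nil
  have "is_run_factorization [] ws \<longleftrightarrow> ws = []" for ws
    by (cases ws) (auto simp: is_run_factorization_def)
  then show ?case by simp
next
  case (Cons x v)
  then obtain r where r: "is_run_factorization v r"
    and r1: "\<And>s. is_run_factorization v s \<Longrightarrow> s = r" by blast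
  have split: "(\<exists>s. ws = [x] # s \<and> is_run_factorization v s \<and> (v \<noteq> [] \<longrightarrow> \<not> x < hd v)) \<or>
      (\<exists>w s. w \<noteq> [] \<and> ws = (x # w) # s \<and> is_run_factorization v (w # s) \<and> x < hd v)"
    if ws: "is_run_factorization (x # v) ws" for ws
  proof -
    obtain w0 s where s: "ws = w0 # s" using ws
      by (cases ws) (auto simp: is_run_factorization_def)
    then obtain w where w: "w0 = x # w" using ws
      by (cases w0) (auto simp: is_run_factorization_def)
    show ?thesis
    proof (cases w)
      case Nil
      then show ?thesis using ws s w
        by (cases s) (auto simp: is_run_factorization_def successively_Cons)
    next
      case (Cons a w')
      then show ?thesis using ws s w
        by (auto simp: is_run_factorization_def successively_Cons)
    qed
  qed
  show ?case
  proof (cases "v \<noteq> [] \<and> x < hd v")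
    case True
    then obtain w s where ws: "r = w # s" using r
      by (cases r) (auto simp: is_run_factorization_def)
    obtain a w' where a: "w = a # w'" using ws r
      by (cases w) (auto simp: is_run_factorization_def)
    have "is_run_factorization (x # v) ((x # w) # s)"
      using r ws a True
      by (auto simp: is_run_factorization_def successively_Cons)
    moreover have "z = (x # w) # s" if "is_run_factorization (x # v) z" for z
      using split[OF that] True r1 ws by auto
    ultimately show ?thesis by blast
  next
    case False
    have "is_run_factorization (x # v) ([x] # r)"
    proof (cases r)
      case Nil
      then show ?thesis using r by (auto simp: is_run_factorization_def)
    next
      case (Cons w s)
      then show ?thesis using r False
        by (cases w) (auto simp: is_run_factorization_def successively_Cons)
    qed
    moreover have "z = [x] # r" if "is_run_factorization (x # v) z" for z
    proof -
      have "concat (w # s) = v" if "is_run_factorization v (w # s)" for w s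
        using that by (simp only: is_run_factorization_def)
      then show ?thesis using split[OF that] False r1 by fastforce
    qed
    ultimately show ?thesis by blast
  qed
qed

definition run_factorization :: "nat list \<Rightarrow> nat list list"
  where "run_factorization \<tau> = (THE ws. is_run_factorization \<tau> ws)"

definition descent_comp :: "nat list \<Rightarrow> nat list"
  where "descent_comp \<tau> = map length (run_factorization \<tau>)"


section \<open>The elements \<open>R\<^sub>I\<^sup>(\<^sup>J\<^sup>)\<close> and the coefficients\<close>

definition R_elem :: "nat \<Rightarrow> nat list \<Rightarrow> nat list \<Rightarrow> (biword \<Rightarrow>\<^sub>0 'a::comm_ring_1)"
  where "R_elem n I J =
    (\<Sum>(\<tau>, \<sigma>) \<in> {(\<tau>, \<sigma>). \<tau> \<in> permutations_of_set {1..n} \<and> \<sigma> \<in> permutations_of_set {1..n} \<and>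
       descent_comp \<tau> = I \<and> saillance_comp \<sigma> = J}. basis (\<sigma>, \<tau>))"

definition c_coeff :: "'a::comm_ring_1 \<Rightarrow> nat list \<Rightarrow> nat list \<Rightarrow> 'a"
  where "c_coeff q I J =
    (if \<not> Des I - Des_minus I \<subseteq> Des J then 0
     else (- q) ^ card (Des I - Des J) * (1 - q) ^ card (Des I \<inter> Des J))"

end

theory Submission
  imports Defs
begin

text \<open>Both sides are compared at a biword with rows \<open>\<sigma>\<close> and \<open>\<tau>\<close>. Expanding the brackets,
  \<open>\<Psi>\<^sup>u\<close> is the sum of the biwords whose bottom row \<open>\<alpha>\<close> first decreases and then increases and whose
  top row is \<open>u\<close> permuted along \<open>\<alpha>\<close>, with coefficient \<open>(- q) ^ d\<close> for \<open>d\<close> descents. Hence the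
  left-hand side is a sum over the ways to cut both rows into blocks such that in every block
  the smallest letter of \<open>\<tau>\<close> stands below the largest letter of \<open>\<sigma>\<close>, and these largest letters
  increase. Reading the biword letter by letter turns this sum into a recursion whose state is the
  current maximum \<open>m\<close> of \<open>\<sigma>\<close> and the last letter \<open>t\<close> of \<open>\<tau>\<close>. In it a descent of \<open>\<tau>\<close> contributes
  \<open>1 - q\<close> if the next letter of \<open>\<sigma>\<close> is a left-to-right maximum, and otherwise \<open>- q\<close> if another
  descent follows and \<open>0\<close> if not, which is \<open>c\<^bsub>IJ\<^esub>(q)\<close>.\<close>

section \<open>Expansion of iterated brackets\<close>

lemma lookup_scale [simp]: "Poly_Mapping.lookup (scale c x) b = c * Poly_Mapping.lookup x b"
  unfolding scale_def by (simp add: Poly_Mapping.map.rep_eq when_def)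

lemma lookup_basis: "Poly_Mapping.lookup (basis b) z = (if z = b then 1 else 0)"
  by (simp add: lookup_single when_def)

lemma lookup_lin_ext:
  assumes "finite S" "Poly_Mapping.keys x \<subseteq> S"
  shows "Poly_Mapping.lookup (lin_ext f x) z =
    (\<Sum>b\<in>S. Poly_Mapping.lookup x b * Poly_Mapping.lookup (f b) z)"
  unfolding lin_ext_def using assms
  by (auto simp: lookup_sum not_in_keys_iff_lookup_eq_zero intro!: sum.mono_neutral_left)

lemma lin_ext_basis [simp]: "lin_ext f (basis b) = f b"
  by (rule poly_mapping_eqI, subst lookup_lin_ext[of "{b}"]) auto

lemma lookup_bilin_ext:
  "Poly_Mapping.lookup (bilin_ext f x y) z =
    (\<Sum>b\<in>Poly_Mapping.keys x. \<Sum>c\<in>Poly_Mapping.keys y.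
      Poly_Mapping.lookup x b * Poly_Mapping.lookup y c * Poly_Mapping.lookup (f b c) z)"
  unfolding bilin_ext_def
  by (subst lookup_lin_ext[OF finite_keys order.refl], subst lookup_lin_ext[OF finite_keys order.refl])
     (simp add: sum_distrib_left mult.assoc)

text \<open>The hypothesis says that \<open>z\<close> has at most one preimage under
  \<open>g\<close>, namely \<open>b0\<close>, and has it exactly if \<open>P\<close> holds; so at
  most one term of the sum survives.\<close>

lemma lookup_lin_ext_basis_inj:
  assumes "\<And>b. g b = z \<longleftrightarrow> P \<and> b = b0"
  shows "Poly_Mapping.lookup (lin_ext (\<lambda>b. basis (g b)) x) z =
    (if P then Poly_Mapping.lookup x b0 else 0)"
proof -
  have "Poly_Mapping.lookup x b * Poly_Mapping.lookup (basis (g b)) z =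
      (if b = b0 then (if P then Poly_Mapping.lookup x b0 else 0) else 0)" for b
    using assms[of b] by (auto simp: lookup_basis)
  then show ?thesis
    by (subst lookup_lin_ext[where S = "insert b0 (Poly_Mapping.keys x)"]) auto
qed

text \<open>One product appends \<open>c\<close>, the other prepends it. Both operations are
  injective on words and are undone by \<open>butlast\<close> and \<open>tl\<close>.\<close>

lemma lookup_q_bracket_letter:
  "Poly_Mapping.lookup (q_bracket q x (basis [c])) y =
    (if y \<noteq> [] \<and> last y = c then Poly_Mapping.lookup x (butlast y) else 0)
    - q * (if y \<noteq> [] \<and> hd y = c then Poly_Mapping.lookup x (tl y) else 0)"
proof -
  have 1: "b @ [c] = y \<longleftrightarrow> (y \<noteq> [] \<and> last y = c) \<and> b = butlast y" for b
    by (auto simp: snoc_eq_iff_butlast)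
  have 2: "c # b = y \<longleftrightarrow> (y \<noteq> [] \<and> hd y = c) \<and> b = tl y" for b
    by auto
  show ?thesis
    unfolding q_bracket_def concat_prod_def bilin_ext_def lookup_minus lookup_scale lin_ext_basis
      append_Cons append_Nil lookup_lin_ext_basis_inj[of "\<lambda>b. b @ [c]" y, OF 1]
      lookup_lin_ext_basis_inj[of "\<lambda>b. c # b" y, OF 2] ..
qed

text \<open>\<open>vee_weight q \<tau>\<close> is \<open>(- q) ^ d\<close> if the nonempty word \<open>\<tau>\<close> first decreases, in \<open>d\<close> steps,
  and then increases, and zero for every other word without repeated letters.\<close>

fun vee_weight :: "'a::comm_ring_1 \<Rightarrow> nat list \<Rightarrow> 'a" where
  "vee_weight q (s # t # \<tau>) =
    (if t < s then - q * vee_weight q (t # \<tau>) else if sorted (s # t # \<tau>) then 1 else 0)"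
| "vee_weight q [t] = 1"
| "vee_weight q [] = 0"

section \<open>Effect of a new largest letter on the weight\<close>

lemma vee_weight_Cons_max:
  "\<tau> \<noteq> [] \<Longrightarrow> \<forall>t\<in>set \<tau>. t < p \<Longrightarrow> vee_weight q (p # \<tau>) = - q * vee_weight q \<tau>"
  by (cases \<tau>) auto

lemma vee_weight_snoc_max:
  "\<tau> \<noteq> [] \<Longrightarrow> \<forall>t\<in>set \<tau>. t < p \<Longrightarrow> vee_weight q (\<tau> @ [p]) = vee_weight q \<tau>"
  by (induction q \<tau> rule: vee_weight.induct) (auto simp: sorted_append)

text \<open>A largest letter strictly inside creates a rise followed by a descent.\<close>

lemma vee_weight_inner_max:
  assumes "x \<noteq> []" "y \<noteq> []" "\<forall>t\<in>set x \<union> set y. t < p"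
  shows "vee_weight q (x @ p # y) = 0"
  using assms
proof (induction x)
  case (Cons a x)
  show ?case
  proof (cases x)
    case Nil
    then show ?thesis using Cons.prems by (cases y) auto
  next
    case (Cons b x')
    then show ?thesis using Cons.IH Cons.prems by (cases y) (auto simp: sorted_append)
  qed
qed simp

lemma sorted_map_strict_mono_on:
  fixes f :: "'b::linorder \<Rightarrow> 'c::linorder"
  shows "strict_mono_on (set xs) f \<Longrightarrow> sorted (map f xs) \<longleftrightarrow> sorted xs"
  by (auto simp: sorted_iff_nth_mono_less strict_mono_on_less_eq)

lemma vee_weight_map:
  "strict_mono_on (set \<tau>) f \<Longrightarrow> vee_weight q (map f \<tau>) = vee_weight q \<tau>"
proof (induction q \<tau> rule: vee_weight.induct)
  case (1 q s t \<tau>)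
  have "f t < f s \<longleftrightarrow> t < s"
    using 1(2) by (simp add: strict_mono_on_less)
  moreover have "sorted (map f (s # t # \<tau>)) \<longleftrightarrow> sorted (s # t # \<tau>)"
    using 1(2) by (rule sorted_map_strict_mono_on)
  moreover have "strict_mono_on (set (t # \<tau>)) f"
    using 1(2) by (rule monotone_on_subset) auto
  ultimately show ?case using 1(1) by simp
qed auto

text \<open>Each new biletter carries the largest number so far, and the bracket puts it at the end
  with factor 1 or in front with factor \<open>- q\<close>. This is how \<open>vee_weight\<close>
  changes under a new largest letter.\<close>

lemma lookup_iterated_q_bracket:
  assumes "sorted_wrt (<) (map snd (b # bs))"
  shows "Poly_Mapping.lookup (foldl (\<lambda>B c. q_bracket q B (basis [c])) (basis [b]) bs) y =
    (if mset y = mset (b # bs) then vee_weight q (map snd y) else 0)"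
  using assms
proof (induction bs arbitrary: y rule: rev_induct)
  case Nil
  have "mset y = mset [b] \<longleftrightarrow> y = [b]" by (auto simp: mset_single_iff)
  then show ?case by (auto simp: lookup_basis)
next
  case (snoc c bs)
  let ?L = "\<lambda>y. Poly_Mapping.lookup (foldl (\<lambda>B c. q_bracket q B (basis [c])) (basis [b]) bs) y"
  have IH: "?L y = (if mset y = mset (b # bs) then vee_weight q (map snd y) else 0)" for y
    using snoc by (auto simp: sorted_wrt_append)
  have lt: "\<forall>d\<in>set (b # bs). snd d < snd c"
    using snoc.prems by (auto simp: sorted_wrt_append)
  then have c: "c \<notin> set (b # bs)" by blast
  have rec: "Poly_Mapping.lookup (foldl (\<lambda>B c. q_bracket q B (basis [c])) (basis [b]) (bs @ [c])) y =
     (if y \<noteq> [] \<and> last y = c then ?L (butlast y) else 0)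
     - q * (if y \<noteq> [] \<and> hd y = c then ?L (tl y) else 0)"
    by (simp add: lookup_q_bracket_letter)
  show ?case
  proof (cases "mset y = mset (b # bs @ [c])")
    case True
    then have "c \<in> set y" by (metis in_set_conv_decomp mset_eq_setD Cons_eq_appendI)
    then obtain y1 y2 where y: "y = y1 @ c # y2" by (meson split_list)
    have m: "mset (y1 @ y2) = mset (b # bs)" using True y by simp
    then have s: "set y1 \<union> set y2 = set (b # bs)" by (metis mset_eq_setD set_append)
    then have lt': "\<forall>t\<in>set (map snd y1) \<union> set (map snd y2). t < snd c" using lt by auto
    have c': "c \<notin> set y1" "c \<notin> set y2" using s c by auto
    have "y1 \<noteq> [] \<or> y2 \<noteq> []" using m by auto
    \<comment> \<open>If \<open>c\<close> stands first or last, exactly one term of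
      \<open>rec\<close> survives; if it stands strictly inside, none does.\<close>
    then consider "y1 = []" "y2 \<noteq> []" | "y1 \<noteq> []" "y2 = []" | "y1 \<noteq> []" "y2 \<noteq> []" by blast
    then show ?thesis
    proof cases
      case 1
      then have "last y \<noteq> c" using c' y by (metis append_Nil last_ConsR last_in_set)
      then show ?thesis unfolding rec IH
        using 1 y m True lt' vee_weight_Cons_max[of "map snd y2" "snd c" q] by auto
    next
      case 2
      then have "hd y \<noteq> c" using c' y by (metis hd_append2 hd_in_set)
      then show ?thesis unfolding rec IH
        using 2 y m True lt' vee_weight_snoc_max[of "map snd y1" "snd c" q] by auto
    next
      case 3
      then have "hd y \<noteq> c" "last y \<noteq> c" using c' y
        by (metis hd_append2 hd_in_set, metis last.simps last_appendR last_in_set list.distinct(1))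
      then show ?thesis unfolding rec
        using 3 y lt' vee_weight_inner_max[of "map snd y1" "map snd y2" "snd c" q] by auto
    qed
  next
    case False
    have "mset (butlast y) \<noteq> mset (b # bs)" if "y \<noteq> []" "last y = c"
      using False that append_butlast_last_id[of y] by (metis append_Cons mset_append)
    moreover have "mset (tl y) \<noteq> mset (b # bs)" if "y \<noteq> []" "hd y = c"
      using False that by (cases y) auto
    ultimately show ?thesis unfolding rec IH using False by auto
  qed
qed

lemma lookup_Psi_word:
  assumes "u \<noteq> []"
  shows "Poly_Mapping.lookup (Psi_word q u) (v, \<tau>) =
    (if length v = length \<tau> \<and> mset (zip v \<tau>) = mset (zip u [1..<Suc (length u)])
     then vee_weight q \<tau> else 0)"
proof -
  obtain b bs where b: "zip u [1..<Suc (length u)] = b # bs"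
    using assms by (cases "zip u [1..<Suc (length u)]") (auto simp del: upt_Suc)
  have s: "sorted_wrt (<) (map snd (b # bs))"
    unfolding b[symmetric] by (subst map_snd_zip) (simp_all del: upt_Suc)
  have inj: "biword_of y = (v, \<tau>) \<longleftrightarrow> (length v = length \<tau>) \<and> y = zip v \<tau>" for y
    by (auto simp: biword_of_def zip_map_fst_snd)
  show ?thesis
    unfolding Psi_word_def b list.case
    by (subst lookup_lin_ext_basis_inj[of biword_of, OF inj])
       (auto simp: lookup_iterated_q_bracket[OF s])
qed

section \<open>Standardization and the product of biwords\<close>

text \<open>Passing to ranks is a strictly increasing map on the letters, so whatever depends only
  on their relative order is unchanged by \<open>std\<close>.\<close>

lemma std_eq_map:
  obtains f where "std \<tau> = map f \<tau>" "strict_mono_on (set \<tau>) f"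
proof
  show "std \<tau> = map (\<lambda>a. card {b \<in> set \<tau>. b \<le> a}) \<tau>" by (rule std_def)
  show "strict_mono_on (set \<tau>) (\<lambda>a. card {b \<in> set \<tau>. b \<le> a})"
  proof (rule strict_mono_onI)
    fix r s assume "r \<in> set \<tau>" "s \<in> set \<tau>" "r < s"
    then have "{b \<in> set \<tau>. b \<le> r} \<subseteq> {b \<in> set \<tau>. b \<le> s}"
        "s \<in> {b \<in> set \<tau>. b \<le> s} - {b \<in> set \<tau>. b \<le> r}" by auto
    then have "{b \<in> set \<tau>. b \<le> r} \<subset> {b \<in> set \<tau>. b \<le> s}" by blast
    then show "card {b \<in> set \<tau>. b \<le> r} < card {b \<in> set \<tau>. b \<le> s}"
      by (intro psubset_card_mono) auto
  qed
qed

lemma length_std [simp]: "length (std \<tau>) = length \<tau>"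
  by (simp add: std_def)

lemma std_Nil [simp]: "std [] = []"
  by (simp add: std_def)

lemma std_map:
  assumes "strict_mono_on (set \<tau>) f"
  shows "std (map f \<tau>) = std \<tau>"
proof -
  have "card {b \<in> f ` set \<tau>. b \<le> f a} = card {b \<in> set \<tau>. b \<le> a}" if "a \<in> set \<tau>" for a
  proof -
    have "{b \<in> f ` set \<tau>. b \<le> f a} = f ` {b \<in> set \<tau>. b \<le> a}"
      using that assms by (auto simp: strict_mono_on_less_eq)
    moreover have "inj_on f {b \<in> set \<tau>. b \<le> a}"
      using strict_mono_on_imp_inj_on[OF assms] by (rule inj_on_subset) auto
    ultimately show ?thesis by (simp add: card_image)
  qed
  then show ?thesis by (simp add: std_def)
qed

lemma std_take_std: "std (take a (std \<tau>)) = std (take a \<tau>)"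
proof -
  obtain f where f: "std \<tau> = map f \<tau>" "strict_mono_on (set \<tau>) f" by (rule std_eq_map)
  have "strict_mono_on (set (take a \<tau>)) f"
    using f(2) set_take_subset by (rule monotone_on_subset)
  then show ?thesis by (simp add: f(1) take_map std_map)
qed

lemma std_drop_std: "std (drop a (std \<tau>)) = std (drop a \<tau>)"
proof -
  obtain f where f: "std \<tau> = map f \<tau>" "strict_mono_on (set \<tau>) f" by (rule std_eq_map)
  have "strict_mono_on (set (drop a \<tau>)) f"
    using f(2) set_drop_subset by (rule monotone_on_subset)
  then show ?thesis by (simp add: f(1) drop_map std_map)
qed

lemma std_in_permutations:
  assumes "distinct \<tau>"
  shows "std \<tau> \<in> permutations_of_set {1..length \<tau>}"
proof -
  obtain f where f: "std \<tau> = map f \<tau>" "strict_mono_on (set \<tau>) f" by (rule std_eq_map)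
  have d: "distinct (std \<tau>)"
    using assms strict_mono_on_imp_inj_on[OF f(2)] by (simp add: f(1) distinct_map)
  have "set (std \<tau>) \<subseteq> {1..length \<tau>}"
  proof
    fix y assume "y \<in> set (std \<tau>)"
    then obtain a where a: "a \<in> set \<tau>" "y = card {b \<in> set \<tau>. b \<le> a}" by (auto simp: std_def)
    have "card {b \<in> set \<tau>. b \<le> a} \<le> card (set \<tau>)" by (intro card_mono) auto
    moreover have "card {b \<in> set \<tau>. b \<le> a} > 0" using a by (subst card_gt_0_iff) auto
    ultimately show "y \<in> {1..length \<tau>}" using a(2) assms by (simp add: distinct_card)
  qed
  moreover have "card (set (std \<tau>)) = length \<tau>" using d by (simp add: distinct_card)
  ultimately have "set (std \<tau>) = {1..length \<tau>}" by (intro card_subset_eq) auto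
  then show ?thesis using d by (simp add: permutations_of_set_def)
qed

lemma std_permutation:
  assumes "\<tau> \<in> permutations_of_set {1..n}"
  shows "std \<tau> = \<tau>"
proof -
  have "card {b \<in> set \<tau>. b \<le> a} = a" if "a \<in> set \<tau>" for a
  proof -
    have "{b \<in> set \<tau>. b \<le> a} = {1..a}" using that assms by (auto dest: permutations_of_setD)
    then show ?thesis by simp
  qed
  then show ?thesis by (simp add: std_def map_idI)
qed

text \<open>In this form \<gamma> determines \<alpha> and \<beta> once their lengths are
  known.\<close>

lemma conv_alt:
  assumes "length \<alpha> = a" "length \<beta> = b"
  shows "\<gamma> \<in> conv \<alpha> \<beta> \<longleftrightarrow>
    \<gamma> \<in> permutations_of_set {1..a + b} \<and> \<alpha> = std (take a \<gamma>) \<and> \<beta> = std (drop a \<gamma>)"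
proof (cases "\<gamma> \<in> permutations_of_set {1..a + b}")
  case True
  then have "length \<gamma> = a + b"
    using length_finite_permutations_of_set[OF True] by simp
  then have "\<gamma> = x @ y \<and> length x = a \<and> length y = b \<and> std x = \<alpha> \<and> std y = \<beta> \<longleftrightarrow>
      x = take a \<gamma> \<and> y = drop a \<gamma> \<and> \<alpha> = std x \<and> \<beta> = std y" for x y
    by (metis append_eq_conv_conj append_take_drop_id length_append add_left_cancel length_take
        min.absorb2 le_add1)
  then show ?thesis
    using True unfolding conv_def assms mem_Collect_eq by simp
qed (use assms in \<open>simp add: conv_def\<close>)

text \<open>The hypotheses make \<open>x\<close> and \<open>y\<close> homogeneous of degrees
  \<open>a\<close> and \<open>b\<close>. The cut is then at position \<open>a\<close>, and only the
  pair of biwords obtained by cutting there and standardizing can contribute.\<close>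

lemma lookup_biword_prod:
  assumes x: "\<forall>u \<alpha>. Poly_Mapping.lookup x (u, \<alpha>) \<noteq> 0 \<longrightarrow> length u = a \<and> length \<alpha> = a"
    and y: "\<forall>v \<beta>. Poly_Mapping.lookup y (v, \<beta>) \<noteq> 0 \<longrightarrow>
      length v = b \<and> length \<beta> = b"
  shows "Poly_Mapping.lookup (biword_prod x y) (w, \<gamma>) =
    (if length w = a + b \<and> \<gamma> \<in> permutations_of_set {1..a + b}
     then Poly_Mapping.lookup x (take a w, std (take a \<gamma>)) *
       Poly_Mapping.lookup y (drop a w, std (drop a \<gamma>))
     else 0)"
proof -
  let ?P = "length w = a + b \<and> \<gamma> \<in> permutations_of_set {1..a + b}"
  let ?x0 = "(take a w, std (take a \<gamma>))" and ?y0 = "(drop a w, std (drop a \<gamma>))"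
  have fin: "finite (conv \<alpha> \<beta>)" for \<alpha> \<beta> by (simp add: conv_def)
  have *: "Poly_Mapping.lookup ((\<lambda>(u, \<alpha>) (v, \<beta>). \<Sum>\<gamma>\<in>conv \<alpha> \<beta>. basis (u @ v, \<gamma>)) b1 b2) (w, \<gamma>) =
      (if b1 = ?x0 \<and> b2 = ?y0 \<and> ?P then 1 else 0 :: 'a)"
    if "b1 \<in> Poly_Mapping.keys x" "b2 \<in> Poly_Mapping.keys y" for b1 b2
  proof -
    obtain u \<alpha> v \<beta> where b: "b1 = (u, \<alpha>)" "b2 = (v, \<beta>)" by (metis surj_pair)
    have l: "length u = a" "length \<alpha> = a" "length v = b" "length \<beta> = b"
      using that x y b by (auto simp: in_keys_iff)
    have w: "w = u @ v \<longleftrightarrow> length w = a + b \<and> u = take a w \<and> v = drop a w"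
      using l(1,3) by (metis append_eq_conv_conj append_take_drop_id length_append)
    have "Poly_Mapping.lookup (\<Sum>\<gamma>\<in>conv \<alpha> \<beta>. basis (u @ v, \<gamma>)) (w, \<gamma>) =
        (\<Sum>\<gamma>'\<in>conv \<alpha> \<beta>. if w = u @ v \<and> \<gamma> = \<gamma>' then 1 else 0 :: 'a)"
      by (simp add: lookup_sum lookup_basis)
    also have "\<dots> = (if w = u @ v \<and> \<gamma> \<in> conv \<alpha> \<beta> then 1 else 0)"
      using fin by (cases "w = u @ v") simp_all
    finally show ?thesis
      by (simp only: b prod.case prod.inject w conv_alt[OF l(2,4)] conj_ac)
  qed
  have "Poly_Mapping.lookup (biword_prod x y) (w, \<gamma>) =
     (\<Sum>b1\<in>Poly_Mapping.keys x. \<Sum>b2\<in>Poly_Mapping.keys y.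
       if b1 = ?x0 then (if b2 = ?y0 then
         (if ?P then Poly_Mapping.lookup x b1 * Poly_Mapping.lookup y b2 else 0) else 0) else 0)"
    unfolding biword_prod_def lookup_bilin_ext
    by (intro sum.cong refl) (simp add: *)
  also have "\<dots> = (\<Sum>b1\<in>Poly_Mapping.keys x. if b1 = ?x0 then \<Sum>b2\<in>Poly_Mapping.keys y.
       (if b2 = ?y0 then
         (if ?P then Poly_Mapping.lookup x b1 * Poly_Mapping.lookup y b2 else 0) else 0) else 0)"
    by (intro sum.cong refl) simp
  also have "\<dots> = (if ?P then Poly_Mapping.lookup x ?x0 * Poly_Mapping.lookup y ?y0 else 0)"
    by (simp add: in_keys_iff del: One_nat_def)
  finally show ?thesis .
qed

text \<open>The unique word \<open>u\<close> such that the biword with rows \<open>v\<close> and \<open>std \<tau>\<close> can occur in \<open>\<Psi>\<^sup>u\<close>.\<close>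

definition unshuffle :: "nat list \<Rightarrow> nat list \<Rightarrow> nat list"
  where "unshuffle v \<tau> = map fst (sort_key snd (zip v (std \<tau>)))"

lemma mset_unshuffle: "length v = length \<tau> \<Longrightarrow> mset (unshuffle v \<tau>) = mset v"
  by (simp only: unshuffle_def mset_map mset_sort)
     (simp only: mset_map[symmetric] map_fst_zip length_std)

lemma length_unshuffle [simp]: "length (unshuffle v \<tau>) = min (length v) (length \<tau>)"
  by (simp add: unshuffle_def)

text \<open>The numbers in the bottom row are distinct and fill \<open>{1..length \<tau>}\<close>,
  so the biletters have a unique arrangement sorted by number; its colors spell
  \<open>u\<close>.\<close>

lemma unshuffle_iff:
  assumes "distinct \<tau>" "length v = length \<tau>"
  shows "mset (zip v (std \<tau>)) = mset (zip u [1..<Suc (length u)]) \<longleftrightarrow> u = unshuffle v \<tau>"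
proof
  have p: "distinct (std \<tau>)" "set (std \<tau>) = {1..length \<tau>}"
    using permutations_of_setD[OF std_in_permutations[OF assms(1)]] by auto
  have inj: "inj_on snd (set (zip v (std \<tau>)))"
    using p(1) assms(2) by (metis distinct_map length_std map_snd_zip)
  {
    assume eq: "mset (zip v (std \<tau>)) = mset (zip u [1..<Suc (length u)])"
    have "sort_key snd (zip v (std \<tau>)) = zip u [1..<Suc (length u)]"
      using eq[symmetric]
    proof (rule sort_key_inj_key_eq[OF sym])
      show "inj_on snd (set (zip v (std \<tau>)))" by (rule inj)
      show "sorted (map snd (zip u [1..<Suc (length u)]))"
        by (subst map_snd_zip) (simp_all del: upt_Suc)
    qed
    then show "u = unshuffle v \<tau>" by (simp add: unshuffle_def del: upt_Suc)
  next
    assume u: "u = unshuffle v \<tau>"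
    let ?s = "sort_key snd (zip v (std \<tau>))"
    have "sorted (map snd ?s)" by (rule sorted_sort_key)
    moreover have m: "mset (map snd ?s) = mset (std \<tau>)"
      using assms by (simp only: mset_map mset_sort)
        (simp only: mset_map[symmetric] map_snd_zip length_std)
    moreover have "sorted [1..<Suc (length \<tau>)]" "distinct [1..<Suc (length \<tau>)]" by (simp_all del: upt_Suc)
    moreover have "set (map snd ?s) = set [1..<Suc (length \<tau>)]"
      using mset_eq_setD[OF m] p by (auto simp del: upt_Suc)
    moreover have "distinct (map snd ?s)" using m p(1) mset_eq_imp_distinct_iff by blast
    ultimately have "map snd ?s = [1..<Suc (length \<tau>)]"
      using sorted_distinct_set_unique by blast
    moreover have "length u = length \<tau>" using u assms by simp
    ultimately have "zip u [1..<Suc (length u)] = ?s"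
      by (metis u unshuffle_def zip_map_fst_snd)
    then show "mset (zip v (std \<tau>)) = mset (zip u [1..<Suc (length u)])" by simp
  }
qed

text \<open>Sorting puts the biletter with the smallest number first, and \<open>std\<close>
  preserves the order, so this is the one above \<open>t\<close>.\<close>

lemma hd_unshuffle:
  assumes "distinct \<tau>" "length v = length \<tau>" "(x, t) \<in> set (zip v \<tau>)" "\<forall>s\<in>set \<tau>. t \<le> s"
  shows "hd (unshuffle v \<tau>) = x"
proof -
  obtain f where f: "std \<tau> = map f \<tau>" "strict_mono_on (set \<tau>) f" by (rule std_eq_map)
  let ?z = "zip v (std \<tau>)"
  have z: "?z = map (\<lambda>(x, t). (x, f t)) (zip v \<tau>)"
    by (simp add: f(1) zip_map2)
  have t: "t \<in> set \<tau>" using assms(3) by (rule set_zip_rightD)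
  have ne: "?z \<noteq> []" using t assms(2)
    by (metis empty_iff length_std list.set(1) list.size(3) length_0_conv length_zip min.idem)
  obtain y s where y: "hd (sort_key snd ?z) = (y, s)" by (metis surj_pair)
  have "hd (sort_key snd ?z) \<in> set (sort_key snd ?z)"
    using ne by (intro hd_in_set) (metis length_0_conv length_sort)
  then obtain s' where s': "(y, s') \<in> set (zip v \<tau>)" "s = f s'" unfolding y by (auto simp: z)
  have "(x, f t) \<in> set (sort_key snd ?z)" using assms(3) by (force simp: z)
  moreover have "sorted (map snd (sort_key snd ?z))" by (rule sorted_sort_key)
  ultimately have "s \<le> f t"
    using y by (cases "sort_key snd ?z") auto
  moreover have "s' \<in> set \<tau>" using s'(1) by (rule set_zip_rightD)
  ultimately have "s' = t" using f(2) t assms(4) s'(2)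
    by (metis strict_mono_on_less_eq order.antisym)
  moreover have "distinct (map snd (zip v \<tau>))" using assms by simp
  ultimately have "y = x" using s'(1) assms(3)
    by (metis distinct_map inj_onD prod.inject snd_conv)
  moreover have "unshuffle v \<tau> = map fst (sort_key snd ?z)" by (simp add: unshuffle_def)
  moreover have "sort_key snd ?z \<noteq> []" using ne by (metis length_0_conv length_sort)
  ultimately show ?thesis using y by (simp add: hd_map)
qed

lemma vee_weight_std [simp]: "vee_weight q (std \<tau>) = vee_weight q \<tau>"
proof -
  obtain f where f: "std \<tau> = map f \<tau>" "strict_mono_on (set \<tau>) f" by (rule std_eq_map)
  show ?thesis unfolding f(1) using f(2) by (rule vee_weight_map)
qed

lemma lookup_Psi_word_std:
  assumes "u \<noteq> []" "distinct \<tau>" "length v = length \<tau>"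
  shows "Poly_Mapping.lookup (Psi_word q u) (v, std \<tau>) =
    (if u = unshuffle v \<tau> then vee_weight q \<tau> else 0)"
  unfolding lookup_Psi_word[OF assms(1)] vee_weight_std unshuffle_iff[OF assms(2,3)]
  using assms(3) by simp

section \<open>Support and coefficients of products of the elements Psi\<close>

lemma Psi_word_support:
  assumes "u \<noteq> []" "Poly_Mapping.lookup (Psi_word q u) (v, \<tau>) \<noteq> 0"
  shows "mset v = mset u" "length \<tau> = length u"
proof -
  have *: "length v = length \<tau>" "mset (zip v \<tau>) = mset (zip u [1..<Suc (length u)])"
    using assms by (auto simp: lookup_Psi_word simp del: upt_Suc split: if_splits)
  show "mset v = mset u"
    using arg_cong[OF *(2), of "image_mset fst"] *(1) by (simp flip: mset_map del: upt_Suc)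
  show "length \<tau> = length u"
    using arg_cong[OF *(2), of size] *(1) by (simp del: upt_Suc)
qed

text \<open>This is \<open>Psi_perm\<close> for an arbitrary list of blocks in place of the
  factorization of a permutation, which permits induction on the list.\<close>

definition Psi_prod :: "'a::comm_ring_1 \<Rightarrow> nat list list \<Rightarrow> (biword \<Rightarrow>\<^sub>0 'a)"
  where "Psi_prod q ws = foldr biword_prod (map (Psi_word q) ws) (basis ([], []))"

text \<open>Homogeneity comes first because \<open>lookup_biword_prod\<close> requires it of both
  factors.\<close>

lemma Psi_prod_support_length:
  assumes "\<forall>w\<in>set ws. w \<noteq> []" "Poly_Mapping.lookup (Psi_prod q ws) (v, \<tau>) \<noteq> 0"
  shows "length v = length (concat ws) \<and> length \<tau> = length (concat ws)"
  using assms
proof (induction ws arbitrary: v \<tau>)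
  case Nil
  then show ?case by (auto simp: Psi_prod_def lookup_basis split: if_splits)
next
  case (Cons w ws)
  have 1: "\<forall>v \<tau>. Poly_Mapping.lookup (Psi_word q w) (v, \<tau>) \<noteq> 0 \<longrightarrow>
      length v = length w \<and> length \<tau> = length w"
    using Psi_word_support[of w q] Cons.prems(1) by (auto dest: mset_eq_length)
  have 2: "\<forall>v \<tau>. Poly_Mapping.lookup (Psi_prod q ws) (v, \<tau>) \<noteq> 0 \<longrightarrow>
      length v = length (concat ws) \<and> length \<tau> = length (concat ws)"
    using Cons.IH Cons.prems(1) by auto
  have P: "Psi_prod q (w # ws) = biword_prod (Psi_word q w) (Psi_prod q ws)"
    by (simp add: Psi_prod_def)
  have l: "length v = length w + length (concat ws)"
      "\<tau> \<in> permutations_of_set {1..length w + length (concat ws)}"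
    using Cons.prems(2) unfolding P lookup_biword_prod[OF 1 2] by (auto split: if_splits)
  then show ?case using length_finite_permutations_of_set[OF l(2)] by simp
qed

lemma lookup_Psi_prod_Cons:
  assumes "\<forall>w\<in>set (w # ws). w \<noteq> []"
  shows "Poly_Mapping.lookup (Psi_prod q (w # ws)) (v, \<tau>) =
    (if length v = length (concat (w # ws)) \<and> \<tau> \<in> permutations_of_set {1..length (concat (w # ws))}
     then Poly_Mapping.lookup (Psi_word q w) (take (length w) v, std (take (length w) \<tau>)) *
       Poly_Mapping.lookup (Psi_prod q ws) (drop (length w) v, std (drop (length w) \<tau>))
     else 0)"
proof -
  have 1: "\<forall>v \<tau>. Poly_Mapping.lookup (Psi_word q w) (v, \<tau>) \<noteq> 0 \<longrightarrow>
      length v = length w \<and> length \<tau> = length w"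
    using Psi_word_support[of w q] assms by (auto dest: mset_eq_length)
  have 2: "\<forall>v \<tau>. Poly_Mapping.lookup (Psi_prod q ws) (v, \<tau>) \<noteq> 0 \<longrightarrow>
      length v = length (concat ws) \<and> length \<tau> = length (concat ws)"
    using Psi_prod_support_length assms by auto
  have P: "Psi_prod q (w # ws) = biword_prod (Psi_word q w) (Psi_prod q ws)"
    by (simp add: Psi_prod_def)
  show ?thesis unfolding P lookup_biword_prod[OF 1 2] by simp
qed

lemma Psi_prod_support:
  assumes "\<forall>w\<in>set ws. w \<noteq> []" "Poly_Mapping.lookup (Psi_prod q ws) (v, \<tau>) \<noteq> 0"
  shows "mset v = mset (concat ws)" "\<tau> \<in> permutations_of_set {1..length (concat ws)}"
proof -
  show "mset v = mset (concat ws)"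
    using assms
  proof (induction ws arbitrary: v \<tau>)
    case Nil
    then show ?case by (auto simp: Psi_prod_def lookup_basis split: if_splits)
  next
    case (Cons w ws)
    have nz: "Poly_Mapping.lookup (Psi_word q w) (take (length w) v, std (take (length w) \<tau>)) \<noteq> 0"
        "Poly_Mapping.lookup (Psi_prod q ws) (drop (length w) v, std (drop (length w) \<tau>)) \<noteq> 0"
      using Cons.prems(2) unfolding lookup_Psi_prod_Cons[OF Cons.prems(1)] by (auto split: if_splits)
    have "mset (take (length w) v) = mset w" "mset (drop (length w) v) = mset (concat ws)"
      using Psi_word_support(1)[OF _ nz(1)] Cons.IH[OF _ nz(2)] Cons.prems(1) by auto
    then show ?case by (metis append_take_drop_id concat.simps(2) mset_append)
  qed
  show "\<tau> \<in> permutations_of_set {1..length (concat ws)}"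
    using assms
    by (cases ws) (auto simp: Psi_prod_def[of _ "[]"] lookup_basis lookup_Psi_prod_Cons
      simp del: concat.simps split: if_splits)
qed

text \<open>The length of the first block determines the block. With a standardized bottom row the
  formula can be iterated, since the remaining factor is again evaluated at a standardized
  suffix.\<close>

lemma lookup_Psi_prod_Cons_std:
  assumes "\<forall>w\<in>set (w # ws). w \<noteq> []" "distinct \<tau>" "length v = length \<tau>"
    "length \<tau> = length (concat (w # ws))"
  shows "Poly_Mapping.lookup (Psi_prod q (w # ws)) (v, std \<tau>) =
    (if w = unshuffle (take (length w) v) (take (length w) \<tau>)
     then vee_weight q (take (length w) \<tau>) *
       Poly_Mapping.lookup (Psi_prod q ws) (drop (length w) v, std (drop (length w) \<tau>)) else 0)"
proof -
  have "std \<tau> \<in> permutations_of_set {1..length (concat (w # ws))}"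
    using std_in_permutations[OF assms(2)] assms(4) by simp
  moreover have "Poly_Mapping.lookup (Psi_word q w) (take (length w) v, std (take (length w) \<tau>)) =
      (if w = unshuffle (take (length w) v) (take (length w) \<tau>)
       then vee_weight q (take (length w) \<tau>) else 0)"
    using assms by (intro lookup_Psi_word_std) auto
  moreover define b where "b \<longleftrightarrow> w = unshuffle (take (length w) v) (take (length w) \<tau>)"
  ultimately show ?thesis
    unfolding lookup_Psi_prod_Cons[OF assms(1)] std_take_std std_drop_std b_def[symmetric]
    using assms(3,4) by simp
qed

section \<open>Sums over factorizations into blocks\<close>

text \<open>The parameters serve a recursion: once the first block is removed, the later ones use
  the remaining colors, and their first letters are bounded below by that of the removed
  block.\<close>

definition dom_lists :: "nat set \<Rightarrow> nat \<Rightarrow> nat list list set"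
  where "dom_lists A m = {ws. concat ws \<in> permutations_of_set A \<and>
    (\<forall>w\<in>set ws. initially_dominated w \<and> m \<le> hd w) \<and> sorted (map hd ws)}"

lemma is_dom_factorization_dom_lists:
  "ws \<in> dom_lists A m \<Longrightarrow> is_dom_factorization (concat ws) ws"
  by (auto simp: dom_lists_def is_dom_factorization_def)

text \<open>Uniqueness of the factorization makes \<open>concat\<close> injective here.\<close>

lemma finite_dom_lists [simp]: "finite (dom_lists A m)"
proof (rule finite_imageD)
  show "inj_on concat (dom_lists A m)"
    by (rule inj_onI) (metis is_dom_factorization_dom_lists ex1_dom_factorization)
  show "finite (concat ` dom_lists A m)"
    by (rule finite_subset[of _ "permutations_of_set A"]) (auto simp: dom_lists_def)
qed

lemma is_dom_factorization_dom_factorization: "is_dom_factorization u (dom_factorization u)"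
  unfolding dom_factorization_def by (rule theI'[OF ex1_dom_factorization])

lemma dom_factorization_eqI: "is_dom_factorization u ws \<Longrightarrow> dom_factorization u = ws"
  using is_dom_factorization_dom_factorization ex1_dom_factorization by blast

lemma sum_Psi_perm:
  "(\<Sum>\<sigma>\<in>permutations_of_set A. Psi_perm q \<sigma>) = (\<Sum>ws\<in>dom_lists A 0. Psi_prod q ws)"
proof (rule sum.reindex_bij_witness[of _ concat dom_factorization])
  fix \<sigma> assume \<sigma>: "\<sigma> \<in> permutations_of_set A"
  show "concat (dom_factorization \<sigma>) = \<sigma>" "dom_factorization \<sigma> \<in> dom_lists A 0"
    using is_dom_factorization_dom_factorization[of \<sigma>] \<sigma>
    by (auto simp: dom_lists_def is_dom_factorization_def)
  show "Psi_prod q (dom_factorization \<sigma>) = Psi_perm q \<sigma>"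
    by (simp add: Psi_prod_def Psi_perm_def)
next
  fix ws assume ws: "ws \<in> dom_lists A 0"
  show "dom_factorization (concat ws) = ws"
    using ws by (intro dom_factorization_eqI is_dom_factorization_dom_lists)
  show "concat ws \<in> permutations_of_set A" using ws by (simp add: dom_lists_def)
qed

lemma dom_lists_nonempty_words: "ws \<in> dom_lists A m \<Longrightarrow> \<forall>w\<in>set ws. w \<noteq> []"
  by (auto simp: dom_lists_def initially_dominated_def)

section \<open>Splitting off the first block\<close>

definition dom_sum :: "'a::comm_ring_1 \<Rightarrow> nat list \<Rightarrow> nat list \<Rightarrow> nat \<Rightarrow> 'a"
  where "dom_sum q v \<tau> m =
    (\<Sum>ws\<in>dom_lists (set v) m. Poly_Mapping.lookup (Psi_prod q ws) (v, std \<tau>))"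

lemma dom_sum_Nil [simp]: "dom_sum q [] [] m = 1"
proof -
  have "dom_lists {} m = {[]}"
  proof (rule set_eqI)
    show "ws \<in> dom_lists {} m \<longleftrightarrow> ws \<in> {[]}" for ws
      by (cases ws) (auto simp: dom_lists_def initially_dominated_def)
  qed
  then show ?thesis by (simp add: dom_sum_def Psi_prod_def lookup_basis)
qed

lemma initially_dominated_iff:
  assumes "distinct w"
  shows "initially_dominated w \<longleftrightarrow> w \<noteq> [] \<and> (\<forall>y\<in>set w. y \<le> hd w)"
  using assms by (cases w) (auto simp: initially_dominated_def order.strict_iff_order)

text \<open>The first letter of an initially dominated block is its maximum, so the bound for the
  later blocks depends only on the set of letters of the prefix of \<open>v\<close>.\<close>

lemma Cons_in_dom_lists_iff:
  assumes "distinct v" "mset w = mset (take j v)"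
  shows "w # ws \<in> dom_lists (set v) m \<longleftrightarrow>
    initially_dominated w \<and> m \<le> hd w \<and> ws \<in> dom_lists (set (drop j v)) (Max (set (take j v)))"
proof (cases "initially_dominated w")
  case True
  have w: "set w = set (take j v)" "distinct w"
    using assms by (auto dest: mset_eq_setD mset_eq_imp_distinct_iff)
  have "\<forall>y\<in>set w. y \<le> hd w" "w \<noteq> []" using True w(2) by (auto simp: initially_dominated_iff)
  then have max: "Max (set (take j v)) = hd w" unfolding w(1)[symmetric]
    by (intro Max_eqI) auto
  have "set v = set (take j v) \<union> set (drop j v)" by (metis append_take_drop_id set_append)
  moreover have "set (take j v) \<inter> set (drop j v) = {}"
    using assms(1) by (metis append_take_drop_id distinct_append)
  ultimately have "w @ u \<in> permutations_of_set (set v) \<longleftrightarrow>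
      u \<in> permutations_of_set (set (drop j v))" for u
    using w unfolding permutations_of_set_def mem_Collect_eq set_append distinct_append w(1) by blast
  from this[of "concat ws"] show ?thesis using True max by (auto simp: dom_lists_def)
qed (simp add: dom_lists_def)

text \<open>\<open>peak m v \<tau>\<close> says that the largest letter of \<open>v\<close> exceeds \<open>m\<close> and stands above the smallest
  letter of \<open>\<tau>\<close>.\<close>

definition peak :: "nat \<Rightarrow> nat list \<Rightarrow> nat list \<Rightarrow> bool"
  where "peak m v \<tau> \<longleftrightarrow>
    (\<exists>(x, t)\<in>set (zip v \<tau>). m < x \<and> (\<forall>s\<in>set \<tau>. t \<le> s) \<and> (\<forall>y\<in>set v. y \<le> x))"

definition block_weight :: "'a::comm_ring_1 \<Rightarrow> nat \<Rightarrow> nat list \<Rightarrow> nat list \<Rightarrow> 'a"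
  where "block_weight q m v \<tau> = (if peak m v \<tau> then vee_weight q \<tau> else 0)"

text \<open>The first letter of \<open>unshuffle v \<tau>\<close> is the one above the smallest
  letter of \<tau>. As \<open>m\<close> does not occur in \<open>v\<close>, weak and strict
  comparison with \<open>m\<close> agree.\<close>

lemma peak_iff_initially_dominated:
  assumes "distinct v" "distinct \<tau>" "length v = length \<tau>" "v \<noteq> []" "m \<notin> set v"
  shows "initially_dominated (unshuffle v \<tau>) \<and> m \<le> hd (unshuffle v \<tau>) \<longleftrightarrow> peak m v \<tau>"
proof -
  let ?w = "unshuffle v \<tau>"
  have w: "set ?w = set v" "distinct ?w"
    using mset_unshuffle[OF assms(3)] assms(1) by (auto dest: mset_eq_setD mset_eq_imp_distinct_iff)
  have ne: "?w \<noteq> []" using w(1) assms(4) by auto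
  have "Min (set \<tau>) \<in> set \<tau>" using assms(3,4) by (intro Min_in) auto
  then obtain i where i: "i < length \<tau>" "\<tau> ! i = Min (set \<tau>)" by (auto simp: in_set_conv_nth)
  then have x: "(v ! i, \<tau> ! i) \<in> set (zip v \<tau>)" "\<forall>s\<in>set \<tau>. \<tau> ! i \<le> s"
    using assms(3) by (auto simp: in_set_zip)
  have "peak m v \<tau> \<longleftrightarrow> m < hd ?w \<and> (\<forall>y\<in>set v. y \<le> hd ?w)"
  proof
    assume "peak m v \<tau>"
    then show "m < hd ?w \<and> (\<forall>y\<in>set v. y \<le> hd ?w)"
      using hd_unshuffle[OF assms(2,3)] by (auto simp: peak_def)
  next
    assume "m < hd ?w \<and> (\<forall>y\<in>set v. y \<le> hd ?w)"
    then show "peak m v \<tau>"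
      using x hd_unshuffle[OF assms(2,3) x] unfolding peak_def by auto
  qed
  moreover have "m \<le> hd ?w \<longleftrightarrow> m < hd ?w"
    using hd_in_set[OF ne] w(1) assms(5) by (metis order.strict_iff_order)
  ultimately show ?thesis using ne w by (auto simp: initially_dominated_iff)
qed

text \<open>For each length \<open>j\<close> only one first block can contribute, the unshuffled
  prefix; so a contributing list amounts to \<open>j\<close> together with the list of later
  blocks.\<close>

lemma dom_sum_first_block:
  assumes "distinct v" "distinct \<tau>" "length v = length \<tau>" "v \<noteq> []" "m \<notin> set v"
  shows "dom_sum q v \<tau> m = (\<Sum>j\<in>{1..length v}. block_weight q m (take j v) (take j \<tau>) *
    dom_sum q (drop j v) (drop j \<tau>) (Max (set (take j v))))"
proof -
  let ?w = "\<lambda>j. unshuffle (take j v) (take j \<tau>)"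
  let ?h = "\<lambda>(j, ws). vee_weight q (take j \<tau>) *
    Poly_Mapping.lookup (Psi_prod q ws) (drop j v, std (drop j \<tau>))"
  let ?D = "dom_lists (set v) m"
  let ?E = "SIGMA j:{1..length v}. dom_lists (set (drop j v)) (Max (set (take j v)))"
  let ?S = "{ws \<in> ?D. hd ws = ?w (length (hd ws))}"
  let ?T = "{(j, ws) \<in> ?E. peak m (take j v) (take j \<tau>)}"
  have ms: "mset (?w j) = mset (take j v)" for j
    using assms(3) by (intro mset_unshuffle) simp
  have len: "length (?w j) = j" if "j \<in> {1..length v}" for j using that assms(3) by simp
  have pk: "initially_dominated (?w j) \<and> m \<le> hd (?w j) \<longleftrightarrow> peak m (take j v) (take j \<tau>)"
    if "j \<in> {1..length v}" for j
    using assms that by (intro peak_iff_initially_dominated) (auto dest: in_set_takeD)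
  have D: "ws \<noteq> [] \<and> hd ws \<noteq> [] \<and> length (hd ws) \<in> {1..length v} \<and> length (concat ws) = length \<tau>"
    if "ws \<in> ?D" for ws
  proof -
    have "concat ws \<in> permutations_of_set (set v)" using that by (simp add: dom_lists_def)
    then have l: "length (concat ws) = length v"
      using assms(1) by (metis distinct_card length_finite_permutations_of_set)
    then obtain w ws' where "ws = w # ws'" using assms(4) by (cases ws) auto
    moreover have "\<forall>w\<in>set ws. w \<noteq> []" using that by (rule dom_lists_nonempty_words)
    ultimately show ?thesis using l assms(3) by (auto simp: Suc_le_eq)
  qed
  have "dom_sum q v \<tau> m = (\<Sum>ws\<in>?D. if hd ws = ?w (length (hd ws)) then ?h (length (hd ws), tl ws) else 0)"
    unfolding dom_sum_def
  proof (rule sum.cong[OF refl])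
    fix ws assume ws: "ws \<in> ?D"
    obtain w ws' where eq: "ws = w # ws'" using D[OF ws] by (cases ws) auto
    show "Poly_Mapping.lookup (Psi_prod q ws) (v, std \<tau>) =
        (if hd ws = ?w (length (hd ws)) then ?h (length (hd ws), tl ws) else 0)"
      unfolding eq
      using D[OF ws] dom_lists_nonempty_words[OF ws] assms(2,3)
      by (subst lookup_Psi_prod_Cons_std) (simp_all only: eq list.sel prod.case)
  qed
  also have "\<dots> = (\<Sum>ws\<in>?S. ?h (length (hd ws), tl ws))"
    by (simp only: sum.inter_filter finite_dom_lists)
  also have "\<dots> = (\<Sum>p\<in>?T. ?h p)"
  \<comment> \<open>The bijection keeps only the length of the first block, from which
    \<open>?w\<close> restores the block.\<close>
  proof (rule sum.reindex_bij_witness[of _ "\<lambda>(j, ws). ?w j # ws" "\<lambda>ws. (length (hd ws), tl ws)"])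
    fix ws assume ws: "ws \<in> ?S"
    let ?j = "length (hd ws)"
    have j: "?j \<in> {1..length v}" "ws \<noteq> []" "hd ws = ?w ?j" using ws D by blast+
    then have eq: "?w ?j # tl ws = ws" by (metis list.collapse)
    then show "(case (?j, tl ws) of (j, ws) \<Rightarrow> ?w j # ws) = ws" by simp
    have "?w ?j # tl ws \<in> ?D" unfolding eq using ws by simp
    then have "peak m (take ?j v) (take ?j \<tau>)"
        "tl ws \<in> dom_lists (set (drop ?j v)) (Max (set (take ?j v)))"
      unfolding Cons_in_dom_lists_iff[OF assms(1) ms] pk[OF j(1), symmetric] by simp_all
    then show "(?j, tl ws) \<in> ?T" using j(1) by simp
    show "?h (?j, tl ws) = ?h (?j, tl ws)" ..
  next
    fix p assume "p \<in> ?T"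
    then obtain j ws where p: "p = (j, ws)" "j \<in> {1..length v}" "peak m (take j v) (take j \<tau>)"
        "ws \<in> dom_lists (set (drop j v)) (Max (set (take j v)))" by auto
    show "(length (hd (case p of (j, ws) \<Rightarrow> ?w j # ws)), tl (case p of (j, ws) \<Rightarrow> ?w j # ws)) = p"
      using p(1) len[OF p(2)] by (simp only: prod.case list.sel)
    show "(case p of (j, ws) \<Rightarrow> ?w j # ws) \<in> ?S"
      using p pk[OF p(2)] len[OF p(2)] Cons_in_dom_lists_iff[OF assms(1) ms, of j ws m]
      by (simp only: prod.case list.sel mem_Collect_eq simp_thms)
  qed
  also have "\<dots> = (\<Sum>p\<in>?E. if peak m (take (fst p) v) (take (fst p) \<tau>) then ?h p else 0)"
    by (subst sum.inter_filter[symmetric]) (auto intro!: sum.cong)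
  also have "\<dots> = (\<Sum>j\<in>{1..length v}. \<Sum>ws\<in>dom_lists (set (drop j v)) (Max (set (take j v))).
      block_weight q m (take j v) (take j \<tau>) *
        Poly_Mapping.lookup (Psi_prod q ws) (drop j v, std (drop j \<tau>)))"
    by (subst sum.Sigma) (auto intro!: sum.cong simp: block_weight_def)
  finally show ?thesis by (simp add: dom_sum_def sum_distrib_left)
qed

section \<open>Reading the first block letter by letter\<close>

definition rise_weight :: "nat \<Rightarrow> nat \<Rightarrow> nat list \<Rightarrow> nat list \<Rightarrow> 'a::comm_ring_1"
  where "rise_weight m t v \<tau> = (if sorted (t # \<tau>) \<and> (\<forall>y\<in>set v. y < m) then 1 else 0)"

text \<open>Either \<open>t\<close> is the smallest letter of the block; then \<open>x\<close> is
  its largest color and the rest rises below smaller colors, as \<open>rise_weight\<close> tests. Or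
  the block descends from \<open>t\<close> at the cost of \<open>- q\<close>; then its largest color
  comes later and must exceed \<open>x\<close> as well. The two cases exclude each other, as
  \<open>rise_weight\<close> vanishes at a descent.\<close>

lemma block_weight_Cons:
  assumes "x \<notin> set v" "t \<notin> set \<tau>" "length v = length \<tau>"
  shows "block_weight q m (x # v) (t # \<tau>) =
    (if m < x then rise_weight x t v \<tau> else 0) +
    (if \<tau> \<noteq> [] \<and> hd \<tau> < t then - q * block_weight q (max m x) v \<tau> else 0)"
proof (cases "\<tau> \<noteq> [] \<and> hd \<tau> < t")
  case True
  then obtain t' \<tau>' where \<tau>: "\<tau> = t' # \<tau>'" "t' < t" by (cases \<tau>) auto
  have "peak m (x # v) (t # \<tau>) \<longleftrightarrow> peak (max m x) v \<tau>"
  proof -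
    have "peak m (x # v) (t # \<tau>) \<longleftrightarrow> (\<exists>(y, s)\<in>set (zip v \<tau>).
        m < y \<and> s \<le> t \<and> (\<forall>r\<in>set \<tau>. s \<le> r) \<and> x \<le> y \<and> (\<forall>z\<in>set v. z \<le> y))"
      unfolding peak_def using \<tau> by auto
    also have "\<dots> \<longleftrightarrow> peak (max m x) v \<tau>"
      unfolding peak_def
    proof (rule bex_cong[OF refl], safe)
      fix y s assume "(y, s) \<in> set (zip v \<tau>)" "m < y" "x \<le> y"
      then show "max m x < y"
        using assms(1) set_zip_leftD[of y s v \<tau>] by (cases "x = y") auto
    next
      fix y s assume "\<forall>r\<in>set \<tau>. s \<le> r"
      then show "s \<le> t" using \<tau> by auto
    qed auto
    finally show ?thesis .
  qed
  then show ?thesis using \<tau> by (auto simp: block_weight_def rise_weight_def)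
next
  case False
  have vw: "vee_weight q (t # \<tau>) = (if sorted (t # \<tau>) then 1 else 0)"
    using False by (cases \<tau>) auto
  have "peak m (x # v) (t # \<tau>) \<longleftrightarrow> m < x \<and> (\<forall>y\<in>set v. y < x)" if "sorted (t # \<tau>)"
  proof -
    have t: "t < s" if "s \<in> set \<tau>" for s
      using that \<open>sorted (t # \<tau>)\<close> assms(2) by (cases "s = t") auto
    have "\<not> (\<forall>r\<in>set (t # \<tau>). s \<le> r)" if "(y, s) \<in> set (zip v \<tau>)" for y s
      using t[OF set_zip_rightD[OF that]] by (simp add: not_le)
    then have "peak m (x # v) (t # \<tau>) \<longleftrightarrow> m < x \<and> (\<forall>s\<in>set \<tau>. t \<le> s) \<and> (\<forall>y\<in>set v. y \<le> x)"
      unfolding peak_def by fastforce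
    moreover have "(\<forall>y\<in>set v. y \<le> x) \<longleftrightarrow> (\<forall>y\<in>set v. y < x)"
      using assms(1) by (metis order.strict_iff_order)
    ultimately show ?thesis using t less_imp_le by blast
  qed
  then show ?thesis using False vw by (auto simp: block_weight_def rise_weight_def)
qed

text \<open>The current block has passed its smallest letter; \<open>t\<close> is its last letter so
  far and \<open>m\<close> its largest color. It absorbs \<open>j\<close> more letters, where
  \<open>j = 0\<close> means that it ends at once.\<close>

definition rise_sum :: "'a::comm_ring_1 \<Rightarrow> nat \<Rightarrow> nat \<Rightarrow> nat list \<Rightarrow> nat list \<Rightarrow> 'a"
  where "rise_sum q m t v \<tau> =
    (\<Sum>j\<in>{0..length v}. rise_weight m t (take j v) (take j \<tau>) * dom_sum q (drop j v) (drop j \<tau>) m)"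

lemma rise_sum_Nil [simp]: "rise_sum q m t [] [] = 1"
  by (simp add: rise_sum_def rise_weight_def)

lemma rise_sum_Cons:
  "rise_sum q m t (x # v) (s # \<tau>) =
    dom_sum q (x # v) (s # \<tau>) m + (if t \<le> s \<and> x < m then rise_sum q m s v \<tau> else 0)"
proof -
  have 0: "rise_weight m t [] [] = (1 :: 'a)" by (simp add: rise_weight_def)
  show ?thesis
  proof (cases "t \<le> s \<and> x < m")
    case True
    then have "rise_weight m t (x # take j v) (s # take j \<tau>) =
        (rise_weight m s (take j v) (take j \<tau>) :: 'a)" for j
      by (simp add: rise_weight_def sorted2 del: sorted_wrt.simps(2))
    then show ?thesis using 0 True
      unfolding rise_sum_def list.size add_Suc_right add_0_right sum.atLeast0_atMost_Suc_shift
      by simp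
  next
    case False
    then have "rise_weight m t (x # take j v) (s # take j \<tau>) = (0 :: 'a)" for j
      by (auto simp: rise_weight_def)
    then show ?thesis using 0
      unfolding if_not_P[OF False] rise_sum_def list.size add_Suc_right add_0_right
        sum.atLeast0_atMost_Suc_shift
      by simp
  qed
qed

text \<open>The two summands of \<open>block_weight_Cons\<close>, summed over the length of the
  first block, give \<open>rise_sum\<close> and the \<open>dom_sum\<close> of the rest.\<close>

lemma dom_sum_Cons:
  assumes "distinct (x # v)" "distinct (t # \<tau>)" "length v = length \<tau>" "m \<notin> set (x # v)"
  shows "dom_sum q (x # v) (t # \<tau>) m = (if m < x then rise_sum q x t v \<tau> else 0) +
    (if \<tau> \<noteq> [] \<and> hd \<tau> < t then - q * dom_sum q v \<tau> (max m x) else 0)"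
proof -
  let ?F = "\<lambda>j. dom_sum q (drop j v) (drop j \<tau>)"
  have "dom_sum q (x # v) (t # \<tau>) m =
      (\<Sum>j\<in>{Suc 0..Suc (length v)}. block_weight q m (take j (x # v)) (take j (t # \<tau>)) *
        dom_sum q (drop j (x # v)) (drop j (t # \<tau>)) (Max (set (take j (x # v)))))"
    using assms by (subst dom_sum_first_block) auto
  also have "\<dots> = (\<Sum>j\<in>{0..length v}. block_weight q m (x # take j v) (t # take j \<tau>) *
      ?F j (Max (set (x # take j v))))"
    by (subst sum.shift_bounds_cl_Suc_ivl) simp
  also have "\<dots> = (\<Sum>j\<in>{0..length v}.
      (if m < x then rise_weight x t (take j v) (take j \<tau>) * ?F j x else 0) +
      (if j \<noteq> 0 \<and> \<tau> \<noteq> [] \<and> hd \<tau> < t then - q *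
        (block_weight q (max m x) (take j v) (take j \<tau>) * ?F j (Max (set (take j v)))) else 0))"
  proof (rule sum.cong[OF refl])
    fix j
    have b: "block_weight q m (x # take j v) (t # take j \<tau>) =
        (if m < x then rise_weight x t (take j v) (take j \<tau>) else 0) +
        (if take j \<tau> \<noteq> [] \<and> hd (take j \<tau>) < t
         then - q * block_weight q (max m x) (take j v) (take j \<tau>) else 0)"
      using assms(1-3) by (intro block_weight_Cons) (auto dest: in_set_takeD)
    \<comment> \<open>The two maxima can differ only where the rise weight vanishes.\<close>
    have 1: "rise_weight x t (take j v) (take j \<tau>) * ?F j (Max (set (x # take j v))) =
        rise_weight x t (take j v) (take j \<tau>) * ?F j x"
    proof (cases "\<forall>y\<in>set (take j v). y < x")
      case True
      then have "Max (set (x # take j v)) = x" by (intro Max_eqI) auto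
      then show ?thesis by simp
    qed (auto simp: rise_weight_def)
    \<comment> \<open>A nonzero weight forces a color above \<open>x\<close> into the prefix, so
      \<open>x\<close> does not affect the maximum.\<close>
    have 2: "block_weight q (max m x) (take j v) (take j \<tau>) * ?F j (Max (set (x # take j v))) =
        block_weight q (max m x) (take j v) (take j \<tau>) * ?F j (Max (set (take j v)))"
    proof (cases "peak (max m x) (take j v) (take j \<tau>)")
      case True
      then obtain y where "x < y" "y \<in> set (take j v)" by (auto simp: peak_def dest: set_zip_leftD)
      then have "x \<le> Max (set (take j v))" "take j v \<noteq> []"
        by (auto intro: order.trans[OF less_imp_le] Max_ge simp del: take_eq_Nil)
      then have "Max (set (x # take j v)) = Max (set (take j v))"
        by (simp add: max_absorb2 del: take_eq_Nil)
      then show ?thesis by simp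
    qed (auto simp: block_weight_def)
    \<comment> \<open>For \<open>j = 0\<close> the block ends before the descent, so the descent
      term is absent; the sum then starts at 1, as in \<open>dom_sum_first_block\<close>.\<close>
    have 3: "take j \<tau> \<noteq> [] \<and> hd (take j \<tau>) < t \<longleftrightarrow> j \<noteq> 0 \<and> \<tau> \<noteq> [] \<and> hd \<tau> < t"
      by (cases j; cases \<tau>) auto
    show "block_weight q m (x # take j v) (t # take j \<tau>) * ?F j (Max (set (x # take j v))) =
      (if m < x then rise_weight x t (take j v) (take j \<tau>) * ?F j x else 0) +
      (if j \<noteq> 0 \<and> \<tau> \<noteq> [] \<and> hd \<tau> < t then - q *
        (block_weight q (max m x) (take j v) (take j \<tau>) * ?F j (Max (set (take j v)))) else 0)"
      unfolding b 3
      by (cases "m < x"; cases "j \<noteq> 0 \<and> \<tau> \<noteq> [] \<and> hd \<tau> < t")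
        (simp_all only: 1 2 distrib_right mult.assoc if_True if_False mult_zero_left simp_thms)
  qed
  also have "\<dots> = (if m < x then rise_sum q x t v \<tau> else 0) +
      (\<Sum>j\<in>{0..length v}. (if j \<noteq> 0 \<and> \<tau> \<noteq> [] \<and> hd \<tau> < t then - q *
          (block_weight q (max m x) (take j v) (take j \<tau>) * ?F j (Max (set (take j v)))) else 0))"
    by (simp add: sum.distrib rise_sum_def)
  also have "(\<Sum>j\<in>{0..length v}. (if j \<noteq> 0 \<and> \<tau> \<noteq> [] \<and> hd \<tau> < t then - q *
          (block_weight q (max m x) (take j v) (take j \<tau>) * ?F j (Max (set (take j v)))) else 0)) =
      (if \<tau> \<noteq> [] \<and> hd \<tau> < t then - q * dom_sum q v \<tau> (max m x) else 0)"
  proof (cases "\<tau> \<noteq> [] \<and> hd \<tau> < t")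
    case True
    have "max m x \<notin> set v" using assms by (auto simp: max_def)
    then have "dom_sum q v \<tau> (max m x) = (\<Sum>j\<in>{1..length v}.
        block_weight q (max m x) (take j v) (take j \<tau>) * ?F j (Max (set (take j v))))"
      using True assms by (intro dom_sum_first_block) auto
    then show ?thesis using True
      by (auto simp: sum_distrib_left intro!: sum.mono_neutral_cong_right)
  qed auto
  finally show ?thesis .
qed

section \<open>Solving the recursion\<close>

fun coef :: "'a::comm_ring_1 \<Rightarrow> nat \<Rightarrow> nat \<Rightarrow> nat list \<Rightarrow> nat list \<Rightarrow> 'a" where
  "coef q m t (x # v) (s # \<tau>) =
    (if t < s then coef q (max m x) s v \<tau>
     else if m < x then (1 - q) * coef q x s v \<tau>
     else if \<tau> \<noteq> [] \<and> hd \<tau> < s then - q * coef q m s v \<tau> else 0)"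
| "coef q m t _ _ = 1"

text \<open>The first left-hand side is what \<open>dom_sum_Cons\<close> yields when a new maximum
  has been read. The two statements support each other: at a descent \<open>rise_sum\<close> equals
  \<open>dom_sum\<close>, so the first becomes the second. In the second, a left-to-right maximum
  leads to the first, and otherwise the factor \<open>- q\<close> of a further descent leads back to
  the second.\<close>

lemma rise_sum_eq_coef:
  assumes "length v = length \<tau>" "distinct v" "distinct (t # \<tau>)" "m \<notin> set v"
  shows "rise_sum q m t v \<tau> + (if \<tau> \<noteq> [] \<and> hd \<tau> < t then - q * dom_sum q v \<tau> m else 0) = coef q m t v \<tau>"
    and "\<tau> \<noteq> [] \<Longrightarrow> hd \<tau> < t \<Longrightarrow> (1 - q) * dom_sum q v \<tau> m = coef q m t v \<tau>"
  using assms
proof (induction v \<tau> arbitrary: m t rule: list_induct2)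
  case Nil
  { case 1 show ?case by simp }
  { case 2 then show ?case by simp }
next
  case (Cons x v s \<tau>)
  have F: "dom_sum q (x # v) (s # \<tau>) m = (if m < x then coef q x s v \<tau> else
      if \<tau> \<noteq> [] \<and> hd \<tau> < s then - q * dom_sum q v \<tau> m else 0)"
    if "distinct (x # v)" "distinct (s # \<tau>)" "m \<notin> set (x # v)" for m
  proof -
    have 0: "dom_sum q (x # v) (s # \<tau>) m = (if m < x then rise_sum q x s v \<tau> else 0) +
        (if \<tau> \<noteq> [] \<and> hd \<tau> < s then - q * dom_sum q v \<tau> (max m x) else 0)"
      using that Cons.hyps by (intro dom_sum_Cons) auto
    show ?thesis
    proof (cases "m < x")
      case True
      then have "max m x = x" by (rule max_absorb2[OF less_imp_le])
      moreover have "rise_sum q x s v \<tau> +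
          (if \<tau> \<noteq> [] \<and> hd \<tau> < s then - q * dom_sum q v \<tau> x else 0) = coef q x s v \<tau>"
        using that by (intro Cons.IH(1)) auto
      ultimately show ?thesis using True unfolding 0 by (simp only: if_True)
    next
      case False
      then have "max m x = m" by simp
      then show ?thesis using that False 0 by simp
    qed
  qed
  \<comment> \<open>This is the second statement, isolated because the descent case of the first
    needs it too.\<close>
  have B: "(1 - q) * dom_sum q (x # v) (s # \<tau>) m = coef q m t (x # v) (s # \<tau>)"
    if "s < t" "distinct (x # v)" "distinct (t # s # \<tau>)" "m \<notin> set (x # v)" for m t
  proof (cases "m < x")
    case True
    then show ?thesis using F[of m] that by simp
  next
    case False
    have "(1 - q) * (- q * dom_sum q v \<tau> m) = - q * coef q m s v \<tau>" if "\<tau> \<noteq> [] \<and> hd \<tau> < s"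
      using Cons.IH(2)[of s m] that \<open>distinct (x # v)\<close> \<open>distinct (t # s # \<tau>)\<close> \<open>m \<notin> set (x # v)\<close>
      by (simp add: mult.left_commute)
    then show ?thesis using F[of m] that False by auto
  qed
  {
    case 2
    show ?case by (rule B) (use 2 in auto)
  next
    case 1
    let ?F = "dom_sum q (x # v) (s # \<tau>) m"
    show ?case
    proof (cases "s < t")
      case True
      then have "rise_sum q m t (x # v) (s # \<tau>) = ?F" by (simp add: rise_sum_Cons)
      then show ?thesis using B[of t m] 1 True by (simp add: algebra_simps)
    next
      case False
      then have st: "t < s" using 1 by auto
      then have r: "rise_sum q m t (x # v) (s # \<tau>) = ?F + (if x < m then rise_sum q m s v \<tau> else 0)"
        by (simp add: rise_sum_Cons)
      show ?thesis
      proof (cases "m < x")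
        case True
        then show ?thesis using r F[of m] 1 st by simp
      next
        case False
        then have "x < m" using 1 by auto
        \<comment> \<open>Here \<open>?F\<close> is the descent term in the first induction
          hypothesis, and continuing the block supplies the \<open>rise_sum\<close>.\<close>
        then show ?thesis using r F[of m] 1 st False Cons.IH(1)[of s m] by (simp add: add.commute)
      qed
    qed
  }
qed

lemma dom_sum_eq_coef:
  assumes "distinct (x # v)" "distinct (t # \<tau>)" "length v = length \<tau>" "m \<notin> set v" "m < x"
  shows "dom_sum q (x # v) (t # \<tau>) m = coef q x t v \<tau>"
proof -
  have "rise_sum q x t v \<tau> +
      (if \<tau> \<noteq> [] \<and> hd \<tau> < t then - q * dom_sum q v \<tau> x else 0) = coef q x t v \<tau>"
    using assms by (intro rise_sum_eq_coef(1)) auto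
  moreover have "max m x = x" using assms(5) by simp
  moreover have "dom_sum q (x # v) (t # \<tau>) m = (if m < x then rise_sum q x t v \<tau> else 0) +
      (if \<tau> \<noteq> [] \<and> hd \<tau> < t then - q * dom_sum q v \<tau> (max m x) else 0)"
    using assms by (intro dom_sum_Cons) auto
  ultimately show ?thesis using assms(5) by (simp only: if_True)
qed

section \<open>Descents and left-to-right maxima\<close>

text \<open>Positions are numbered from zero. In \<open>descents t \<tau>\<close> the word \<open>\<tau>\<close> is preceded by the letter
  \<open>t\<close>; \<open>records m v\<close> only counts left-to-right maxima that exceed \<open>m\<close>.\<close>

definition descents :: "nat \<Rightarrow> nat list \<Rightarrow> nat set"
  where "descents t \<tau> = {d. d < length \<tau> \<and> \<tau> ! d \<le> (t # \<tau>) ! d}"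

definition records :: "nat \<Rightarrow> nat list \<Rightarrow> nat set"
  where "records m v = {d. d < length v \<and> m < v ! d \<and> (\<forall>i<d. v ! i < v ! d)}"

text \<open>This is \<open>c_coeff\<close> with both descent sets shifted down by one, since the
  first letter of each row has already been read.\<close>

definition set_coef :: "'a::comm_ring_1 \<Rightarrow> nat set \<Rightarrow> nat set \<Rightarrow> 'a"
  where "set_coef q D S = (if \<forall>d\<in>D. Suc d \<in> D \<or> d \<in> S
    then (- q) ^ card (D - S) * (1 - q) ^ card (D \<inter> S) else 0)"

lemma descents_Nil [simp]: "descents t [] = {}"
  by (simp add: descents_def)

lemma descents_Cons:
  "descents t (s # \<tau>) = (if s \<le> t then {0} else {}) \<union> Suc ` descents s \<tau>"
proof (rule set_eqI)
  show "d \<in> descents t (s # \<tau>) \<longleftrightarrow> d \<in> (if s \<le> t then {0} else {}) \<union> Suc ` descents s \<tau>" for d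
    by (cases d) (auto simp: descents_def image_iff)
qed

lemma records_Cons:
  "records m (x # v) = (if m < x then {0} else {}) \<union> Suc ` records (max m x) v"
proof (rule set_eqI)
  show "d \<in> records m (x # v) \<longleftrightarrow> d \<in> (if m < x then {0} else {}) \<union> Suc ` records (max m x) v" for d
    by (cases d) (auto simp: records_def image_iff All_less_Suc2)
qed

lemma finite_descents [simp]: "finite (descents t \<tau>)"
  by (simp add: descents_def)

text \<open>Prepending a letter shifts all positions; \<open>b\<close> and \<open>s\<close> tell
  whether the new position 0 lies in the two sets. Its successor is a descent exactly if
  \<open>0 \<in> D\<close>.\<close>

lemma set_coef_shift:
  assumes "finite D"
  shows "set_coef q ((if b then {0} else {}) \<union> Suc ` D) ((if s then {0} else {}) \<union> Suc ` S) =
    (if \<not> b then set_coef q D S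
     else if s then (1 - q) * set_coef q D S
     else if 0 \<in> D then - q * set_coef q D S else 0)"
proof -
  let ?D = "(if b then {0} else {}) \<union> Suc ` D" and ?S = "(if s then {0} else {}) \<union> Suc ` S"
  have diff: "?D - ?S = (if b \<and> \<not> s then {0} else {}) \<union> Suc ` (D - S)"
    and int: "?D \<inter> ?S = (if b \<and> s then {0} else {}) \<union> Suc ` (D \<inter> S)" by auto
  have c: "card ((if b' then {0} else {}) \<union> Suc ` A) = (if b' then 1 else 0) + card A"
    if "finite A" for b' and A :: "nat set"
    using that by (simp add: card_image card_insert_if)
  have run: "(\<forall>d\<in>?D. Suc d \<in> ?D \<or> d \<in> ?S) \<longleftrightarrow>
      (b \<longrightarrow> s \<or> 0 \<in> D) \<and> (\<forall>d\<in>D. Suc d \<in> D \<or> d \<in> S)" by auto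
  show ?thesis
    unfolding set_coef_def diff int run using assms by
    (auto simp: c card_image mult.assoc mult.left_commute)
qed

lemma coef_eq_set_coef:
  assumes "length v = length \<tau>" "distinct (t # \<tau>)"
  shows "coef q m t v \<tau> = set_coef q (descents t \<tau>) (records m v)"
  using assms
proof (induction v \<tau> arbitrary: m t rule: list_induct2)
  case Nil
  show ?case by (simp add: set_coef_def)
next
  case (Cons x v s \<tau>)
  have IH: "set_coef q (descents s \<tau>) (records m v) = coef q m s v \<tau>" for m
    using Cons by simp
  have "0 \<in> descents s \<tau> \<longleftrightarrow> \<tau> \<noteq> [] \<and> hd \<tau> < s"
    using Cons.prems by (cases \<tau>) (auto simp: descents_def)
  then show ?case
    unfolding descents_Cons records_Cons set_coef_shift[OF finite_descents] IH
    by (auto simp: max_def not_less)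
qed

section \<open>Descent sets of compositions as sets of block starts\<close>

definition block_starts :: "nat list \<Rightarrow> nat set"
  where "block_starts I = {sum_list (take k I) | k. k < length I}"

lemma block_starts_Nil [simp]: "block_starts [] = {}"
  by (simp add: block_starts_def)

text \<open>Including the start 0 of the first block gives a recursion on the list.
  \<open>Des\<close> is recovered by removing 0 if the first part is positive.\<close>

lemma block_starts_Cons: "block_starts (a # I) = insert 0 ((+) a ` block_starts I)"
proof -
  have "block_starts (a # I) = (\<lambda>k. sum_list (take k (a # I))) ` {..<Suc (length I)}"
    unfolding block_starts_def by auto
  also have "\<dots> = insert 0 ((\<lambda>k. a + sum_list (take k I)) ` {..<length I})"
    unfolding lessThan_Suc_eq_insert_0 image_insert image_image by simp
  also have "\<dots> = insert 0 ((+) a ` block_starts I)"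
    unfolding block_starts_def by auto
  finally show ?thesis .
qed

lemma Des_Cons: "Des (a # I) = (+) a ` block_starts I"
proof -
  have "Des (a # I) = (\<lambda>k. sum_list (take k (a # I))) ` {1..<Suc (length I)}"
    unfolding Des_def by auto
  also have "{1..<Suc (length I)} = Suc ` {..<length I}"
    by (simp add: lessThan_atLeast0 image_Suc_atLeastLessThan)
  also have "(\<lambda>k. sum_list (take k (a # I))) ` \<dots> = (\<lambda>k. a + sum_list (take k I)) ` {..<length I}"
    unfolding image_image by simp
  also have "\<dots> = (+) a ` block_starts I"
    unfolding block_starts_def by auto
  finally show ?thesis .
qed

lemma records_append_small:
  "\<forall>y\<in>set u. y < m \<Longrightarrow> records m (u @ v) = (+) (length u) ` records m v"
  by (induction u) (auto simp: records_Cons max_def image_image)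

text \<open>Inside a block nothing exceeds the first letter, and distinctness makes the weakly
  increasing first letters strictly increasing.\<close>

lemma records_concat:
  assumes "\<forall>w\<in>set ws. initially_dominated w \<and> m < hd w" "sorted (map hd ws)" "distinct (concat ws)"
  shows "records m (concat ws) = block_starts (map length ws)"
  using assms
proof (induction ws arbitrary: m)
  case Nil
  then show ?case by (simp add: records_def)
next
  case (Cons w ws)
  obtain x u where w: "w = x # u" using Cons.prems(1) by (cases w) (auto simp: initially_dominated_def)
  have x: "m < x" "\<forall>y\<in>set u. y < x" using Cons.prems(1) w by (auto simp: initially_dominated_def)
  have "x < hd w'" if "w' \<in> set ws" for w'
  proof -
    have "x \<le> hd w'" using Cons.prems(2) that w by auto
    moreover have "hd w' \<in> set (concat ws)"
      using Cons.prems(1) that by (auto simp: initially_dominated_def intro!: bexI[of _ w'])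
    then have "x \<noteq> hd w'" using Cons.prems(3) w by auto
    ultimately show ?thesis by simp
  qed
  then have "records x (concat ws) = block_starts (map length ws)"
    using Cons.prems by (intro Cons.IH) auto
  then show ?case
    using x by (simp add: w records_Cons records_append_small block_starts_Cons image_image max_def)
qed

lemma Des_saillance_comp:
  assumes "distinct (x # v)" "0 < x" "0 \<notin> set v"
  shows "Des (saillance_comp (x # v)) = Suc ` records x v"
proof -
  let ?ws = "dom_factorization (x # v)"
  have ws: "concat ?ws = x # v" "\<forall>w\<in>set ?ws. initially_dominated w" "sorted (map hd ?ws)"
    using is_dom_factorization_dom_factorization[of "x # v"] by (auto simp: is_dom_factorization_def)
  have pos: "0 < hd w" if "w \<in> set ?ws" for w
  proof -
    have "hd w \<in> set (concat ?ws)"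
      using ws(2) that by (auto simp: initially_dominated_def intro!: bexI[of _ w])
    then show ?thesis unfolding ws(1) using assms(2,3) by (auto intro: gr0I)
  qed
  \<comment> \<open>All colors exceed 0, so this bound counts every left-to-right maximum, including
    position 0.\<close>
  have "records 0 (concat ?ws) = block_starts (map length ?ws)"
    using ws assms(1) pos by (intro records_concat) auto
  then have R: "insert 0 (Suc ` records x v) = block_starts (saillance_comp (x # v))"
    unfolding ws(1) saillance_comp_def using assms(2) by (simp add: records_Cons)
  obtain w ws' where eq: "?ws = w # ws'" using ws(1) by (cases ?ws) auto
  have "length w \<noteq> 0" using ws(2) eq by (auto simp: initially_dominated_def)
  then have "Des (saillance_comp (x # v)) = block_starts (saillance_comp (x # v)) - {0}"
    unfolding saillance_comp_def eq by (auto simp: Des_Cons block_starts_Cons)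
  then show ?thesis unfolding R[symmetric] by auto
qed

lemma is_run_factorization_run_factorization: "is_run_factorization \<tau> (run_factorization \<tau>)"
  unfolding run_factorization_def by (rule theI'[OF ex1_run_factorization])

lemma descents_append_increasing:
  "sorted_wrt (<) (t # u) \<Longrightarrow> descents t (u @ v) = (+) (length u) ` descents (last (t # u)) v"
  by (induction u arbitrary: t) (auto simp: descents_Cons image_image)

text \<open>Every later maximal run starts right after a descent; the second hypothesis makes
  position 0 a descent too, so that all runs are alike.\<close>

lemma descents_concat:
  assumes "is_run_factorization \<tau> ws" "ws \<noteq> [] \<longrightarrow> \<not> t < hd (hd ws)"
  shows "descents t \<tau> = block_starts (map length ws)"
  using assms
proof (induction ws arbitrary: t \<tau>)
  case Nil
  then show ?case by (simp add: is_run_factorization_def)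
next
  case (Cons w ws)
  obtain s u where w: "w = s # u"
    using Cons.prems(1) by (cases w) (auto simp: is_run_factorization_def)
  have "descents (last w) (concat ws) = block_starts (map length ws)"
    using Cons.prems(1)
    by (intro Cons.IH) (auto simp: is_run_factorization_def successively_Cons)
  moreover have "\<tau> = s # u @ concat ws" "sorted_wrt (<) (s # u)" "s \<le> t"
    using Cons.prems w by (auto simp: is_run_factorization_def)
  ultimately show ?case
    using w by (simp add: descents_Cons descents_append_increasing block_starts_Cons image_image
        del: sorted_wrt.simps)
qed

lemma Des_descent_comp: "Des (descent_comp (t # \<tau>)) = Suc ` descents t \<tau>"
proof -
  let ?ws = "run_factorization (t # \<tau>)"
  have ws: "is_run_factorization (t # \<tau>) ?ws" by (rule is_run_factorization_run_factorization)
  obtain w ws' where eq: "?ws = w # ws'" using ws by (cases ?ws) (auto simp: is_run_factorization_def)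
  have w: "w \<noteq> []" "w @ concat ws' = t # \<tau>" using ws eq by (auto simp: is_run_factorization_def)
  then have "hd w = t" by (cases w) auto
  \<comment> \<open>With its own first letter in front, the word has a descent at position 0, since
    \<open>descents\<close> compares weakly.\<close>
  then have "descents t (t # \<tau>) = block_starts (descent_comp (t # \<tau>))"
    unfolding descent_comp_def using ws eq by (intro descents_concat) auto
  then have R: "insert 0 (Suc ` descents t \<tau>) = block_starts (descent_comp (t # \<tau>))"
    by (simp add: descents_Cons)
  have "Des (descent_comp (t # \<tau>)) = block_starts (descent_comp (t # \<tau>)) - {0}"
    unfolding descent_comp_def eq using w(1) by (auto simp: Des_Cons block_starts_Cons)
  then show ?thesis unfolding R[symmetric] by auto
qed

lemma c_coeff_eq_set_coef:
  assumes "Des I = Suc ` D" "Des J = Suc ` S"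
  shows "c_coeff q I J = set_coef q D S"
proof -
  have "Des_minus I = (\<lambda>d. d - 1) ` Suc ` D" unfolding Des_minus_def assms by blast
  then have "Des_minus I = D" by (simp add: image_image)
  moreover have "Suc ` D - D \<subseteq> Suc ` S \<longleftrightarrow> (\<forall>d\<in>D. Suc d \<in> D \<or> d \<in> S)" by auto
  moreover have "Suc ` D - Suc ` S = Suc ` (D - S)" "Suc ` D \<inter> Suc ` S = Suc ` (D \<inter> S)" by auto
  ultimately show ?thesis by (auto simp: c_coeff_def set_coef_def assms card_image)
qed

section \<open>Comparison of the two sides\<close>

lemma descent_comp_in_compositions: "descent_comp \<tau> \<in> compositions (length \<tau>)"
proof -
  have "concat (run_factorization \<tau>) = \<tau>" "\<forall>w\<in>set (run_factorization \<tau>). w \<noteq> []"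
    using is_run_factorization_run_factorization[of \<tau>] by (auto simp: is_run_factorization_def)
  then show ?thesis
    by (auto simp: compositions_def descent_comp_def Suc_le_eq simp flip: length_concat)
qed

lemma saillance_comp_in_compositions: "saillance_comp \<sigma> \<in> compositions (length \<sigma>)"
proof -
  have "concat (dom_factorization \<sigma>) = \<sigma>" "\<forall>w\<in>set (dom_factorization \<sigma>). w \<noteq> []"
    using is_dom_factorization_dom_factorization[of \<sigma>]
    by (auto simp: is_dom_factorization_def initially_dominated_def)
  then show ?thesis
    by (auto simp: compositions_def saillance_comp_def Suc_le_eq simp flip: length_concat)
qed

lemma finite_compositions [simp]: "finite (compositions n)"
proof (rule finite_subset)
  show "finite {I. set I \<subseteq> {..n} \<and> length I \<le> n}" by (simp add: finite_lists_length_le)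
  have "length I \<le> sum_list I" if "\<forall>i\<in>set I. i \<ge> 1" for I :: "nat list"
    using that by (induction I) auto
  then show "compositions n \<subseteq> {I. set I \<subseteq> {..n} \<and> length I \<le> n}"
    by (auto simp: compositions_def intro: member_le_sum_list)
qed

lemma lookup_R_elem:
  "Poly_Mapping.lookup (R_elem n I J) (\<sigma>, \<tau>) =
    (if \<tau> \<in> permutations_of_set {1..n} \<and> \<sigma> \<in> permutations_of_set {1..n} \<and>
       descent_comp \<tau> = I \<and> saillance_comp \<sigma> = J then 1 else 0)"
proof -
  let ?P = "permutations_of_set {1..n}"
  let ?A = "{(\<tau>, \<sigma>). \<tau> \<in> ?P \<and> \<sigma> \<in> ?P \<and> descent_comp \<tau> = I \<and> saillance_comp \<sigma> = J}"
  have fin: "finite ?A" by (rule finite_subset[of _ "?P \<times> ?P"]) auto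
  have "Poly_Mapping.lookup (R_elem n I J) (\<sigma>, \<tau>) = (\<Sum>p\<in>?A. if p = (\<tau>, \<sigma>) then 1 else 0)"
    unfolding R_elem_def lookup_sum
    by (intro sum.cong refl) (auto simp: lookup_basis split: if_splits)
  then show ?thesis using fin by simp
qed

theorem corollary3p4:
  fixes q :: "'a::comm_ring_1" and n :: nat
  assumes "n \<ge> 1"
  shows "(\<Sum>\<sigma>\<in>permutations_of_set {1..n}. Psi_perm q \<sigma>) =
    (\<Sum>I\<in>compositions n. \<Sum>J\<in>compositions n. scale (c_coeff q I J) (R_elem n I J))"
proof (rule poly_mapping_eqI)
  fix z :: biword
  obtain \<sigma> \<tau> where z: "z = (\<sigma>, \<tau>)" by (metis surj_pair)
  let ?P = "permutations_of_set {1..n}"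
  let ?l = "Poly_Mapping.lookup (\<Sum>\<sigma>\<in>?P. Psi_perm q \<sigma>) z"
  let ?r = "Poly_Mapping.lookup (\<Sum>I\<in>compositions n. \<Sum>J\<in>compositions n.
    scale (c_coeff q I J) (R_elem n I J)) z"
  have l: "?l = (\<Sum>ws\<in>dom_lists {1..n} 0. Poly_Mapping.lookup (Psi_prod q ws) z)"
    by (simp add: sum_Psi_perm lookup_sum)
  have r: "?r = (\<Sum>I\<in>compositions n. \<Sum>J\<in>compositions n.
      c_coeff q I J * Poly_Mapping.lookup (R_elem n I J) z)"
    by (simp add: lookup_sum)
  show "?l = ?r"
  proof (cases "\<sigma> \<in> ?P \<and> \<tau> \<in> ?P")
    case True
    then have \<sigma>: "set \<sigma> = {1..n}" "distinct \<sigma>" "length \<sigma> = n"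
      and \<tau>: "distinct \<tau>" "length \<tau> = n" "std \<tau> = \<tau>"
      using length_finite_permutations_of_set[of _ "{1..n}"] std_permutation[of \<tau> n]
      by (auto dest: permutations_of_setD)
    obtain x v where v: "\<sigma> = x # v" using \<sigma>(3) assms by (cases \<sigma>) auto
    obtain t u where u: "\<tau> = t # u" using \<tau>(2) assms by (cases \<tau>) auto
    have "0 \<notin> set \<sigma>" unfolding \<sigma>(1) by simp
    then have pos: "0 < x" "0 \<notin> set v" unfolding v by auto
    have "?l = dom_sum q \<sigma> \<tau> 0" using l unfolding dom_sum_def \<sigma>(1) z \<tau>(3) .
    also have "\<dots> = coef q x t v u"
      unfolding u v using \<sigma> \<tau> u v pos by (intro dom_sum_eq_coef) auto
    also have "\<dots> = set_coef q (descents t u) (records x v)"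
      using \<sigma> \<tau> u v by (intro coef_eq_set_coef) auto
    also have "\<dots> = c_coeff q (descent_comp \<tau>) (saillance_comp \<sigma>)"
      unfolding u v using \<sigma>(2) v pos
      by (intro c_coeff_eq_set_coef[symmetric] Des_descent_comp Des_saillance_comp) auto
    also have "\<dots> = ?r"
    proof -
      \<comment> \<open>A pair of permutations occurs in a single \<open>R_elem\<close>, so one term
        of the double sum remains.\<close>
      have "c_coeff q I J * Poly_Mapping.lookup (R_elem n I J) z =
          (if J = saillance_comp \<sigma> then if I = descent_comp \<tau> then c_coeff q I J else 0 else 0)" for I J
        using True by (auto simp: z lookup_R_elem)
      then show ?thesis
        unfolding r using descent_comp_in_compositions[of \<tau>]
          saillance_comp_in_compositions[of \<sigma>] \<sigma>(3) \<tau>(2)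
        by simp
    qed
    finally show ?thesis .
  next
    case False
    \<comment> \<open>Products of blocks are supported on biwords whose colors rearrange
      \<open>concat ws\<close>, so both sides vanish here.\<close>
    have "Poly_Mapping.lookup (Psi_prod q ws) z = 0" if ws: "ws \<in> dom_lists {1..n} 0" for ws
    proof (rule ccontr)
      assume nz: "Poly_Mapping.lookup (Psi_prod q ws) z \<noteq> 0"
      have cw: "concat ws \<in> ?P" using ws by (simp add: dom_lists_def)
      have supp: "mset \<sigma> = mset (concat ws)" "\<tau> \<in> permutations_of_set {1..length (concat ws)}"
        using Psi_prod_support[OF dom_lists_nonempty_words[OF ws] nz[unfolded z]] .
      have "set \<sigma> = {1..n}" "distinct \<sigma>"
        using permutations_of_setD[OF cw] mset_eq_setD[OF supp(1)] mset_eq_imp_distinct_iff[OF supp(1)]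
        by (simp_all only:)
      moreover have "length (concat ws) = n"
        using length_finite_permutations_of_set[OF cw] by simp
      ultimately show False using False supp(2) by (simp add: permutations_of_setI)
    qed
    moreover have "Poly_Mapping.lookup (R_elem n I J) z = (0 :: 'a)" for I J
      using False by (auto simp: z lookup_R_elem)
    ultimately show ?thesis unfolding l r by simp
  qed
qed

end
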